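(* Let $\varepsilon>0$ be arbitrarily small and let $n\ge n_\varepsilon$ be sufficiently large. Then Breaker wins the Hamiltonian game with bias $b$ on the complete digraph $\vec{K}_n$ if $b\geq \frac{(1+\varepsilon)n}{\log n}$. Furthermore, there exists an absolute constant $\beta>0$ such that, for all sufficiently large $n$, Maker wins the Hamiltonian game with bias $b$ on $\vec{K}_n$ if $b\leq \frac{\beta n}{\log n}$.
   Context: $\vec{K}_n$ is the complete digraph on vertex set $[n]=\{1,\dots,n\}$, containing every ordered pair $(i,j)$ with $i\ne j$ as an edge. In a biased Maker-Breaker game on $\vec{K}_n$ with bias $b$ (a positive integer), the players alternately claim previously unclaimed edges of $\vec{K}_n$. Maker goes first and claims one edge on each of her turns; Breaker claims $b$ edges on each of his turns. Play continues until there are no edges left to take (the last move may be partial), and the sets of edges claimed by the two players are disjoint. Let $D_M$ be the digraph with vertex set $[n]$ whose edges are those claimed by Maker. In the Hamiltonian game, Maker wins if on termination $D_M$ is Hamiltonian, i.e. contains a directed cycle through all $n$ vertices; otherwise Breaker wins. "Maker wins" (respectively "Breaker wins") for a given $n$ and $b$ means that this player has a strategy that wins against every strategy of the opponent. $\log$ is the natural logarithm. *)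

theory Defs
  imports Complex_Main "Graph_Theory.Pair_Digraph"
begin

section \<open>Digraphs\<close>

definition complete_dgraph :: "nat \<Rightarrow> nat pair_pre_digraph" where
  "complete_dgraph n =
     \<lparr>pverts = {1..n}, parcs = {(i, j). i \<in> {1..n} \<and> j \<in> {1..n} \<and> i \<noteq> j}\<rparr>"

text \<open>A cycle is the list of its arcs, so the vertices it visits are the tails of these arcs.\<close>

definition hamiltonian :: "('a, 'b) pre_digraph \<Rightarrow> bool" where
  "hamiltonian G \<longleftrightarrow> (\<exists>p. pre_digraph.cycle G p \<and> tail G ` set p = verts G)"


section \<open>Biased Maker-Breaker games\<close>

text \<open>
  A history is the list of the moves made so far, oldest first, each move being the set of
  elements claimed in it. Maker makes the moves number 0, 2, 4, \<dots>, Breaker the others.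
\<close>

type_synonym 'a history = "'a set list"
type_synonym 'a strategy = "'a history \<Rightarrow> 'a set"

definition unclaimed :: "'a set \<Rightarrow> 'a history \<Rightarrow> 'a set" where
  "unclaimed X h = X - \<Union> (set h)"

definition maker_claims :: "'a history \<Rightarrow> 'a set" where
  "maker_claims h = \<Union> {h ! k | k. k < length h \<and> even k}"

definition turn_bias :: "nat \<Rightarrow> 'a history \<Rightarrow> nat" where
  "turn_bias b h = (if even (length h) then 1 else b)"

text \<open>The minimum lets the last move of the game be partial.\<close>

definition legal_move :: "'a set \<Rightarrow> nat \<Rightarrow> 'a history \<Rightarrow> 'a set \<Rightarrow> bool" where
  "legal_move X b h m \<longleftrightarrow>
     m \<subseteq> unclaimed X h \<and> card m = min (turn_bias b h) (card (unclaimed X h))"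

inductive legal_history :: "'a set \<Rightarrow> nat \<Rightarrow> 'a history \<Rightarrow> bool" for X b where
  start: "legal_history X b []"
| move: "legal_history X b h \<Longrightarrow> unclaimed X h \<noteq> {} \<Longrightarrow> legal_move X b h m \<Longrightarrow>
    legal_history X b (h @ [m])"

definition maker_strategy :: "'a set \<Rightarrow> nat \<Rightarrow> 'a strategy \<Rightarrow> bool" where
  "maker_strategy X b s \<longleftrightarrow>
     (\<forall>h. legal_history X b h \<and> even (length h) \<and> unclaimed X h \<noteq> {} \<longrightarrow> legal_move X b h (s h))"

definition breaker_strategy :: "'a set \<Rightarrow> nat \<Rightarrow> 'a strategy \<Rightarrow> bool" where
  "breaker_strategy X b t \<longleftrightarrow>
     (\<forall>h. legal_history X b h \<and> odd (length h) \<and> unclaimed X h \<noteq> {} \<longrightarrow> legal_move X b h (t h))"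

primrec play :: "'a set \<Rightarrow> 'a strategy \<Rightarrow> 'a strategy \<Rightarrow> nat \<Rightarrow> 'a history" where
  "play X s t 0 = []"
| "play X s t (Suc k) =
     (let h = play X s t k
      in if unclaimed X h = {} then h
         else h @ [if even (length h) then s h else t h])"

text \<open>
  If the board is finite and the bias positive, every legal move claims at least one
  element, so the game has ended after at most \<open>card X\<close> moves.
\<close>

definition final_maker_claims :: "'a set \<Rightarrow> 'a strategy \<Rightarrow> 'a strategy \<Rightarrow> 'a set" where
  "final_maker_claims X s t = maker_claims (play X s t (card X))"

text \<open>The predicate \<open>W\<close> tells which final sets of claimed elements are a win for Maker.\<close>

definition maker_wins :: "'a set \<Rightarrow> nat \<Rightarrow> ('a set \<Rightarrow> bool) \<Rightarrow> bool" where
  "maker_wins X b W \<longleftrightarrow>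
     (\<exists>s. maker_strategy X b s \<and>
       (\<forall>t. breaker_strategy X b t \<longrightarrow> W (final_maker_claims X s t)))"

definition breaker_wins :: "'a set \<Rightarrow> nat \<Rightarrow> ('a set \<Rightarrow> bool) \<Rightarrow> bool" where
  "breaker_wins X b W \<longleftrightarrow>
     (\<exists>t. breaker_strategy X b t \<and>
       (\<forall>s. maker_strategy X b s \<longrightarrow> \<not> W (final_maker_claims X s t)))"


section \<open>The Hamiltonian game\<close>

definition maker_digraph_hamiltonian :: "nat \<Rightarrow> (nat \<times> nat) set \<Rightarrow> bool" where
  "maker_digraph_hamiltonian n M \<longleftrightarrow> hamiltonian (with_proj \<lparr>pverts = {1..n}, parcs = M\<rparr>)"

definition maker_wins_hamiltonian :: "nat \<Rightarrow> nat \<Rightarrow> bool" where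
  "maker_wins_hamiltonian n b \<longleftrightarrow>
     maker_wins (parcs (complete_dgraph n)) b (maker_digraph_hamiltonian n)"

definition breaker_wins_hamiltonian :: "nat \<Rightarrow> nat \<Rightarrow> bool" where
  "breaker_wins_hamiltonian n b \<longleftrightarrow>
     breaker_wins (parcs (complete_dgraph n)) b (maker_digraph_hamiltonian n)"

end

theory Submission
  imports Defs "HOL-Real_Asymp.Real_Asymp" "HOL-Analysis.Convex"
begin

text \<open>
  Breaker ignores the first phase of the game and then plays the box game on the out-stars: while \<open>k\<close> stars
  are free of Maker's arcs he claims about \<open>b / k\<close> arcs in each of them. As \<open>b (ln b - 1) \<ge> n\<close>, some
  star is exhausted before Maker enters it.

  Maker first claims, greedily for an exponential potential, an arc between any two disjoint sets
  of sizes about \<open>n / (200 ln n)\<close> and \<open>n / 24\<close>; this takes \<open>O (n ln n)\<close> moves. Meanwhile all vertices are kept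
  in a system of vertex-disjoint paths. Whenever Breaker has claimed many arcs at the loose side of the end of
  a path, that path is merged with another one, so that by the box game no loose side is ever blocked.
  Then she extends one path to length \<open>n / 4\<close> and closes it, and finally absorbs the other paths into the cycle.
  Absorbing a path \<open>p\<close> costs three moves: an arc from the cycle to \<open>p\<close> opens the cycle into a longer path, an
  arc from its end starts a chain of rotations, and these rotations lead to so many other ends
  that Breaker cannot have blocked all the arcs from them back to the start. The existence of the rotations
  does not depend on how the cycle came about: it follows from the pseudorandomness of the first stage alone.
\<close>

section \<open>Strategies from invariants\<close>

text \<open>A single rotation as in undirected graphs would reverse a segment, which directed arcs
  forbid; hence the rotations use two arcs and keep all directions. The second obstacle is that
  Maker must claim the first arc of a chain before Breaker replies, so one arc, and not a whole set
  of them, has to lead to many ends. Therefore a set of \<open>2 ^ m\<close> candidates for this arc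
  is halved once per window: the candidates together reach twice as many cut points as needed, so
  one half of them keeps its share, until a single candidate is left. All later arcs of the chain
  are already Maker's.

  The smallness of \<beta> enters through Breaker's total: within the \<open>O (n ln n)\<close>
  moves of the strategy he claims at most \<open>n * n / 20000\<close> arcs. Hence at most
  \<open>n / 25\<close> merges are forced on Maker, and few vertices have a large in-count. A forced
  merge may double the hitting potential; the resulting \<open>2 ^ n\<close> is harmless, since the
  greedy moves have to beat the number \<open>2 * 4 ^ n\<close> of rectangles anyway.\<close>

definition breaker_claims :: "'a history \<Rightarrow> 'a set" where
  "breaker_claims h = \<Union> {h ! k | k. k < length h \<and> odd k}"

lemma maker_claims_Nil [simp]: "maker_claims [] = {}"
  and breaker_claims_Nil [simp]: "breaker_claims [] = {}"
  by (auto simp: maker_claims_def breaker_claims_def)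

lemma nth_snoc_parity:
  "{(h @ [m]) ! k | k. k < length (h @ [m]) \<and> P k} =
     {h ! k | k. k < length h \<and> P k} \<union> (if P (length h) then {m} else {})"
proof -
  have "{(h @ [m]) ! k | k. k < length (h @ [m]) \<and> P k} =
      (\<lambda>k. (h @ [m]) ! k) ` {k. k < length (h @ [m]) \<and> P k}"
    by blast
  also have "{k. k < length (h @ [m]) \<and> P k} =
      {k. k < length h \<and> P k} \<union> {k. k = length h \<and> P k}"
    by (auto simp: less_Suc_eq)
  also note image_Un
  also have "(\<lambda>k. (h @ [m]) ! k) ` {k. k < length h \<and> P k} = {h ! k | k. k < length h \<and> P k}"
    by (auto simp: nth_append)
  also have "(\<lambda>k. (h @ [m]) ! k) ` {k. k = length h \<and> P k} = (if P (length h) then {m} else {})"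
    by auto
  finally show ?thesis .
qed

lemma maker_claims_snoc:
  "maker_claims (h @ [m]) = (if even (length h) then maker_claims h \<union> m else maker_claims h)"
  unfolding maker_claims_def nth_snoc_parity by simp

lemma breaker_claims_snoc:
  "breaker_claims (h @ [m]) = (if odd (length h) then breaker_claims h \<union> m else breaker_claims h)"
  unfolding breaker_claims_def nth_snoc_parity by simp

lemma unclaimed_conv: "unclaimed X h = X - maker_claims h - breaker_claims h"
proof -
  have "\<Union> (set h) = maker_claims h \<union> breaker_claims h"
    by (fastforce simp: maker_claims_def breaker_claims_def in_set_conv_nth)
  then show ?thesis by (auto simp: unclaimed_def)
qed

lemma legal_history_claims:
  assumes "legal_history X b h"
  shows "maker_claims h \<subseteq> X" "breaker_claims h \<subseteq> X" "maker_claims h \<inter> breaker_claims h = {}"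
  using assms
  by (induction rule: legal_history.induct)
     (auto simp: maker_claims_snoc breaker_claims_snoc legal_move_def unclaimed_conv)

lemma legal_move_exists:
  assumes "finite X"
  shows "\<exists>m. legal_move X b h m"
proof -
  have "finite (unclaimed X h)" using assms by (simp add: unclaimed_def)
  then obtain m where "m \<subseteq> unclaimed X h"
    "card m = min (turn_bias b h) (card (unclaimed X h))"
    by (meson min.cobounded2 obtain_subset_with_card_n)
  then show ?thesis by (auto simp: legal_move_def)
qed

lemma play_legal:
  assumes "maker_strategy X b s" "breaker_strategy X b t"
  shows "legal_history X b (play X s t k)"
  using assms
  by (induction k) (auto simp: Let_def maker_strategy_def breaker_strategy_def
      intro: legal_history.intros)

lemma play_step:
  assumes "h = play X s t k" "unclaimed X h \<noteq> {}"
  shows "play X s t (Suc k) = h @ [if even (length h) then s h else t h]"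
  using assms by (simp add: Let_def)

lemma play_stop:
  assumes "h = play X s t k" "unclaimed X h = {}"
  shows "play X s t (Suc k) = h"
  using assms by (simp add: Let_def)

lemma play_exhausts_board:
  assumes "finite X" "b \<ge> 1" "maker_strategy X b s" "breaker_strategy X b t"
  shows "unclaimed X (play X s t (card X)) = {}"
proof -
  have "card (unclaimed X (play X s t k)) \<le> card X - k" for k
  proof (induction k)
    case 0
    then show ?case using assms(1) by (simp add: unclaimed_def)
  next
    case (Suc k)
    define h where "h = play X s t k"
    define m where "m = (if even (length h) then s h else t h)"
    show ?case
    proof (cases "unclaimed X h = {}")
      case True
      show ?thesis using Suc by (simp only: play_stop[OF h_def True]) (simp add: True)
    next
      case False
      have "legal_move X b h m"
        using assms(3,4) play_legal[OF assms(3,4), of k] False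
        by (auto simp: m_def h_def maker_strategy_def breaker_strategy_def)
      moreover have fin: "finite (unclaimed X h)" using assms(1) by (simp add: unclaimed_def)
      moreover have "card (unclaimed X h) > 0" using False fin by (simp add: card_gt_0_iff)
      ultimately have m: "m \<subseteq> unclaimed X h" "card m \<ge> 1"
        using assms(2) by (auto simp: legal_move_def turn_bias_def split: if_splits)
      have "unclaimed X (h @ [m]) = unclaimed X h - m"
        by (auto simp: unclaimed_def)
      then have "card (unclaimed X (h @ [m])) = card (unclaimed X h) - card m"
        using m fin by (metis card_Diff_subset finite_subset)
      moreover have "play X s t (Suc k) = h @ [m]"
        using False by (simp add: h_def m_def Let_def)
      ultimately show ?thesis using Suc m by (simp add: h_def)
    qed
  qed
  from this[of "card X"] show ?thesis
    using assms(1) by (simp add: unclaimed_def)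
qed

text \<open>\<open>I\<close> speaks of positions with Maker to move. The condition
  \<open>card R \<le> b\<close> instead of equality covers a partial last move and, with
  \<open>R = {}\<close>, a game that ends with a move of Maker.\<close>

lemma maker_wins_by_invariant:
  assumes fin: "finite X" and b: "b \<ge> 1"
    and start: "I {} {}"
    and maker: "\<And>M B. I M B \<Longrightarrow> M \<union> B \<subseteq> X \<Longrightarrow> M \<inter> B = {} \<Longrightarrow> X - M - B \<noteq> {} \<Longrightarrow>
        \<exists>e\<in>X - M - B. \<forall>R \<subseteq> X - M - B - {e}. card R \<le> b \<longrightarrow> I (insert e M) (B \<union> R)"
    and final: "\<And>M B. I M B \<Longrightarrow> M \<union> B = X \<Longrightarrow> M \<inter> B = {} \<Longrightarrow> W M"
  shows "maker_wins X b W"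
proof -
  \<comment> \<open>A strategy must be legal after every legal history, also where the invariant has
    been lost; there any unclaimed element is good.\<close>
  define good where "good h e \<longleftrightarrow> e \<in> unclaimed X h \<and>
      (I (maker_claims h) (breaker_claims h) \<longrightarrow> (\<forall>R \<subseteq> unclaimed X h - {e}. card R \<le> b \<longrightarrow>
         I (insert e (maker_claims h)) (breaker_claims h \<union> R)))" for h e
  define s where "s h = {SOME e. good h e}" for h
  have s: "\<exists>e. s h = {e} \<and> good h e" if "legal_history X b h" "unclaimed X h \<noteq> {}" for h
  proof -
    have "\<exists>e. good h e"
    proof (cases "I (maker_claims h) (breaker_claims h)")
      case True
      then show ?thesis
        using maker[OF True] legal_history_claims[OF that(1)] that(2)
        unfolding good_def unclaimed_conv by blast
    qed (use that(2) in \<open>auto simp: good_def\<close>)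
    then show ?thesis unfolding s_def by (metis someI)
  qed
  have "maker_strategy X b s"
    unfolding maker_strategy_def legal_move_def
  proof (intro allI impI)
    fix h assume h: "legal_history X b h \<and> even (length h) \<and> unclaimed X h \<noteq> {}"
    then obtain e where e: "s h = {e}" "good h e" using s by blast
    have "card (unclaimed X h) \<ge> 1"
      using h fin by (simp add: card_gt_0_iff Suc_le_eq unclaimed_def)
    then show "s h \<subseteq> unclaimed X h \<and> card (s h) = min (turn_bias b h) (card (unclaimed X h))"
      using e h by (auto simp: good_def turn_bias_def)
  qed
  moreover have "W (final_maker_claims X s t)" if t: "breaker_strategy X b t" for t
  proof -
    define J where "J h \<longleftrightarrow> (if even (length h) then I (maker_claims h) (breaker_claims h)
       else \<forall>R \<subseteq> unclaimed X h. card R \<le> b \<longrightarrow> I (maker_claims h) (breaker_claims h \<union> R))" for h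
    have legal: "legal_history X b (play X s t k)" for k
      using play_legal \<open>maker_strategy X b s\<close> t by blast
    have J: "J (play X s t k)" for k
    proof (induction k)
      case 0
      show ?case
        using start by (simp only: J_def play.simps list.size even_zero if_True
            maker_claims_Nil breaker_claims_Nil)
    next
      case (Suc k)
      define h where "h = play X s t k"
      show ?case
      proof (cases "unclaimed X h = {}")
        case True
        show ?thesis using Suc by (simp only: play_stop[OF h_def True] h_def)
      next
        case False
        have hl: "legal_history X b h" using legal h_def by simp
        have Jh: "J h" using Suc by (simp only: h_def)
        show ?thesis
        proof (cases "even (length h)")
          case True
          obtain e where e: "s h = {e}" "good h e" using s[OF hl False] by blast
          have "unclaimed X (h @ [s h]) = unclaimed X h - {e}"
            by (auto simp: unclaimed_def e)
          moreover have "I (maker_claims h) (breaker_claims h)"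
            using Jh True unfolding J_def by presburger
          then have "\<forall>R \<subseteq> unclaimed X h - {e}. card R \<le> b \<longrightarrow>
              I (insert e (maker_claims h)) (breaker_claims h \<union> R)"
            using e(2) unfolding good_def by blast
          ultimately have "J (h @ [s h])"
            using e(1) True by (simp add: J_def maker_claims_snoc breaker_claims_snoc)
          then show ?thesis using True by (simp only: play_step[OF h_def False] if_True)
        next
          case odd: False
          have "legal_move X b h (t h)"
            using t hl False odd by (auto simp: breaker_strategy_def)
          then have "t h \<subseteq> unclaimed X h" "card (t h) \<le> b"
            using odd by (auto simp: legal_move_def turn_bias_def)
          then have "I (maker_claims h) (breaker_claims h \<union> t h)"
            using Jh odd unfolding J_def by presburger
          then have "J (h @ [t h])"
            using odd by (simp add: J_def maker_claims_snoc breaker_claims_snoc)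
          then show ?thesis using odd by (simp only: play_step[OF h_def False] if_False)
        qed
      qed
    qed
    define h where "h = play X s t (card X)"
    have empty: "unclaimed X h = {}"
      using play_exhausts_board[OF fin b \<open>maker_strategy X b s\<close> t] by (simp add: h_def)
    have "J h" using J by (simp add: h_def)
    moreover have "{} \<subseteq> unclaimed X h \<and> card ({} :: 'a set) \<le> b" by simp
    ultimately have "I (maker_claims h) (breaker_claims h)"
      unfolding J_def by (metis (no_types, lifting) sup_bot_right)
    moreover have "maker_claims h \<union> breaker_claims h = X"
      "maker_claims h \<inter> breaker_claims h = {}"
      using empty legal_history_claims[OF legal[of "card X", folded h_def]]
      by (auto simp: unclaimed_conv)
    ultimately show ?thesis using final by (simp add: final_maker_claims_def h_def)
  qed
  ultimately show ?thesis by (auto simp: maker_wins_def)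
qed

text \<open>\<open>I\<close> is for Maker to move, \<open>J\<close> for Breaker to move.
  \<open>R0\<close> is what the strategy asks for; a legal move pads it to the prescribed size, so
  \<open>I\<close> must survive any further free elements.\<close>

lemma breaker_wins_by_invariant:
  assumes fin: "finite X" and b: "b \<ge> 1"
    and start: "I {} {}"
    and maker: "\<And>M B e. I M B \<Longrightarrow> e \<in> X - M - B \<Longrightarrow> J (insert e M) B"
    and breaker: "\<And>M B. J M B \<Longrightarrow> M \<union> B \<subseteq> X \<Longrightarrow> M \<inter> B = {} \<Longrightarrow>
        \<exists>R0 \<subseteq> X - M - B. card R0 \<le> b \<and> (\<forall>R. R0 \<subseteq> R \<longrightarrow> R \<subseteq> X - M - B \<longrightarrow> I M (B \<union> R))"
    and final: "\<And>M B. I M B \<or> J M B \<Longrightarrow> \<not> W M"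
  shows "breaker_wins X b W"
proof -
  define good where "good h m \<longleftrightarrow> legal_move X b h m \<and>
      (J (maker_claims h) (breaker_claims h) \<longrightarrow> I (maker_claims h) (breaker_claims h \<union> m))" for h m
  define t where "t h = (SOME m. good h m)" for h
  have t: "good h (t h)" if h: "legal_history X b h" "odd (length h)" for h
  proof -
    let ?U = "unclaimed X h"
    have finU: "finite ?U" using fin by (simp add: unclaimed_def)
    have "\<exists>m. good h m"
    proof (cases "J (maker_claims h) (breaker_claims h)")
      case True
      obtain R0 where R0: "R0 \<subseteq> ?U" "card R0 \<le> b"
        "\<And>R. R0 \<subseteq> R \<Longrightarrow> R \<subseteq> ?U \<Longrightarrow> I (maker_claims h) (breaker_claims h \<union> R)"
        using breaker[OF True] legal_history_claims[OF h(1)] unfolding unclaimed_conv by blast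
      have "card R0 \<le> min b (card ?U)" using R0 finU by (simp add: card_mono)
      then obtain m where "R0 \<subseteq> m" "m \<subseteq> ?U" "card m = min b (card ?U)"
        using exists_subset_between[of R0 "min b (card ?U)" ?U] R0(1) finU by auto
      then have "good h m" using R0(3) h(2)
        by (auto simp: good_def legal_move_def turn_bias_def)
      then show ?thesis by blast
    next
      case False
      then show ?thesis using legal_move_exists[OF fin] by (auto simp: good_def)
    qed
    then show ?thesis unfolding t_def by (rule someI_ex)
  qed
  have ts: "breaker_strategy X b t"
    unfolding breaker_strategy_def using t unfolding good_def by blast
  moreover have "\<not> W (final_maker_claims X s t)" if s: "maker_strategy X b s" for s
  proof -
    define K where "K h \<longleftrightarrow> (if even (length h) then I (maker_claims h) (breaker_claims h)
       else J (maker_claims h) (breaker_claims h))" for h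
    have legal: "legal_history X b (play X s t k)" for k
      using play_legal[OF s ts] .
    have K: "K (play X s t k)" for k
    proof (induction k)
      case 0
      show ?case
        using start by (simp only: K_def play.simps list.size even_zero if_True
            maker_claims_Nil breaker_claims_Nil)
    next
      case (Suc k)
      define h where "h = play X s t k"
      show ?case
      proof (cases "unclaimed X h = {}")
        case True
        show ?thesis using Suc by (simp only: play_stop[OF h_def True] h_def)
      next
        case False
        have hl: "legal_history X b h" using legal h_def by simp
        have Kh: "K h" using Suc by (simp add: h_def)
        show ?thesis
        proof (cases "even (length h)")
          case True
          have "legal_move X b h (s h)"
            using s hl False True by (auto simp: maker_strategy_def)
          moreover have "card (unclaimed X h) \<ge> 1"
            using False fin by (simp add: card_gt_0_iff Suc_le_eq unclaimed_def)
          ultimately have "s h \<subseteq> unclaimed X h" "card (s h) = 1"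
            using True by (auto simp: legal_move_def turn_bias_def)
          then obtain e where e: "s h = {e}" "e \<in> X - maker_claims h - breaker_claims h"
            unfolding unclaimed_conv by (metis (lifting) card_1_singletonE insert_subset)
          have "I (maker_claims h) (breaker_claims h)" using Kh True by (simp add: K_def)
          from maker[OF this e(2)] have "K (h @ [s h])"
            using True e(1) by (simp add: K_def maker_claims_snoc breaker_claims_snoc)
          then show ?thesis using True by (simp only: play_step[OF h_def False] if_True)
        next
          case odd: False
          have "J (maker_claims h) (breaker_claims h)" using Kh odd by (simp add: K_def)
          then have "I (maker_claims h) (breaker_claims h \<union> t h)"
            using t[OF hl odd] by (simp add: good_def)
          then have "K (h @ [t h])"
            using odd by (simp add: K_def maker_claims_snoc breaker_claims_snoc)
          then show ?thesis using odd by (simp only: play_step[OF h_def False] if_False)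
        qed
      qed
    qed
    define h where "h = play X s t (card X)"
    have "I (maker_claims h) (breaker_claims h) \<or> J (maker_claims h) (breaker_claims h)"
      using K[of "card X"] unfolding K_def h_def by presburger
    then show ?thesis using final unfolding final_maker_claims_def h_def by blast
  qed
  ultimately show ?thesis by (auto simp: breaker_wins_def)
qed

text \<open>
  Maker is to move and holds \<open>M\<close>, Breaker holds \<open>B\<close>. Maker may name an element that she already owns,
  and \<open>M\<close> may grow arbitrarily: only the elements of \<open>B\<close> have to be avoided, and the end of
  the game needs no separate treatment.
\<close>

inductive can_force :: "'a set \<Rightarrow> nat \<Rightarrow> ('a set \<Rightarrow> bool) \<Rightarrow> 'a set \<Rightarrow> 'a set \<Rightarrow> bool"
  for X b W where
  reached: "W M \<Longrightarrow> can_force X b W M B"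
| claim: "e \<in> X \<Longrightarrow> e \<notin> B \<Longrightarrow>
    (\<And>M' B'. insert e M \<subseteq> M' \<Longrightarrow> M' \<subseteq> X \<Longrightarrow> B \<subseteq> B' \<Longrightarrow> B' \<subseteq> X \<Longrightarrow> M' \<inter> B' = {} \<Longrightarrow>
       card (B' - B) \<le> b \<Longrightarrow> can_force X b W M' B') \<Longrightarrow> can_force X b W M B"

text \<open>\<open>can_force\<close> serves as its own invariant.\<close>

lemma maker_wins_if_can_force:
  assumes fin: "finite X" and b: "b \<ge> 1"
    and mono: "\<And>M M'. W M \<Longrightarrow> M \<subseteq> M' \<Longrightarrow> M' \<subseteq> X \<Longrightarrow> W M'"
    and force: "can_force X b W {} {}"
  shows "maker_wins X b W"
proof (rule maker_wins_by_invariant[where I = "can_force X b W", OF fin b force])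
  fix M B assume *: "can_force X b W M B" "M \<union> B \<subseteq> X" "M \<inter> B = {}" "X - M - B \<noteq> {}"
  obtain f where f: "f \<in> X - M - B" using *(4) by blast
  from *(1) show "\<exists>e\<in>X - M - B. \<forall>R \<subseteq> X - M - B - {e}. card R \<le> b \<longrightarrow>
      can_force X b W (insert e M) (B \<union> R)"
  proof cases
    case reached
    then have "W (insert f M)" using mono f *(2) by blast
    then have "can_force X b W (insert f M) (B \<union> R)" for R by (rule can_force.reached)
    then show ?thesis using f by blast
  next
    case (claim e)
    \<comment> \<open>If the named element is already Maker's, she spends the turn on an arbitrary
      free \<open>f\<close>; the rule permits a larger \<open>M'\<close>.\<close>
    define g where "g = (if e \<in> M then f else e)"
    have g: "g \<in> X - M - B" using claim f by (auto simp: g_def)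
    have "can_force X b W (insert g M) (B \<union> R)" if R: "R \<subseteq> X - M - B - {g}" "card R \<le> b" for R
    proof (rule claim(3))
      show "insert e M \<subseteq> insert g M" by (auto simp: g_def)
      have "B \<union> R - B = R" using R by blast
      then show "card (B \<union> R - B) \<le> b" using R by simp
    qed (use g R *(2,3) in auto)
    then show ?thesis using g by blast
  qed
next
  fix M B assume "can_force X b W M B" "M \<union> B = X" "M \<inter> B = {}"
  then show "W M"
  proof (induction rule: can_force.induct)
    case (claim e B M)
    \<comment> \<open>On a full board the named element lies in \<open>M\<close>, so the position is
      among its own successors and the derivation runs down to \<open>reached\<close>.\<close>
    have "insert e M = M" using claim by blast
    then show ?case using claim.IH[of M B] claim.prems by auto
  qed
qed

section \<open>Hamiltonian digraphs\<close>

abbreviation board :: "nat \<Rightarrow> (nat \<times> nat) set" where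
  "board n \<equiv> parcs (complete_dgraph n)"

lemma board_iff: "(u, v) \<in> board n \<longleftrightarrow> u \<in> {1..n} \<and> v \<in> {1..n} \<and> u \<noteq> v"
  by (simp add: complete_dgraph_def)

lemma finite_board [simp]: "finite (board n)"
  by (rule finite_subset[of _ "{1..n} \<times> {1..n}"]) (auto simp: complete_dgraph_def)

lemma card_board_le: "card (board n) \<le> n * n"
proof -
  have "card (board n) \<le> card ({1..n} \<times> {1..n})"
    by (rule card_mono) (auto simp: complete_dgraph_def)
  then show ?thesis by (simp add: card_cartesian_product)
qed

section \<open>Paths and cycles as vertex lists\<close>

abbreviation path_in :: "('a \<times> 'a) set \<Rightarrow> 'a list \<Rightarrow> bool" where
  "path_in M \<equiv> successively (\<lambda>u v. (u, v) \<in> M)"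

definition cycle_in :: "('a \<times> 'a) set \<Rightarrow> 'a list \<Rightarrow> bool" where
  "cycle_in M g \<longleftrightarrow> g \<noteq> [] \<and> distinct g \<and> path_in M g \<and> (last g, hd g) \<in> M"

lemma path_in_mono: "path_in M p \<Longrightarrow> M \<subseteq> M' \<Longrightarrow> path_in M' p"
  by (erule successively_mono) auto

lemma path_in_set_zip: "path_in M p \<Longrightarrow> set (zip p (tl p)) \<subseteq> M"
  by (induction "\<lambda>u v. (u, v) \<in> M" p rule: successively.induct) auto

lemma cas_zip:
  "pre_digraph.cas (with_proj G) u (zip (u # xs) (xs @ [v])) v"
  by (induction xs arbitrary: u) (simp_all add: pre_digraph.cas.simps)

lemma hamiltonian_if_cycle_in:
  assumes g: "cycle_in M g" and set: "set g = {1..n}"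
  shows "maker_digraph_hamiltonian n M"
proof -
  let ?G = "with_proj \<lparr>pverts = {1..n}, parcs = M\<rparr>"
  obtain u xs where gu: "g = u # xs" using g by (cases g) (auto simp: cycle_in_def)
  let ?p = "zip (u # xs) (xs @ [u])"
  have "hd g = u" by (simp add: gu)
  then have "path_in M (g @ [u])"
    using g by (simp add: cycle_in_def successively_append_iff)
  from path_in_set_zip[OF this] have arcs: "set ?p \<subseteq> M"
    using zip_append1[of "u # xs" "[u]" "xs @ [u]"] by (simp add: gu)
  have cas: "pre_digraph.cas ?G u ?p u" by (rule cas_zip)
  have fst: "map fst ?p = g" by (simp add: gu)
  have snd: "map snd ?p = xs @ [u]" by simp
  have "pre_digraph.awalk ?G u ?p u"
    unfolding pre_digraph.awalk_def using arcs cas set by (auto simp: gu)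
  moreover have "tl (pre_digraph.awalk_verts ?G u ?p) = xs @ [u]"
    using pre_digraph.awalk_verts_conv'[OF cas] snd by simp
  moreover have "distinct (xs @ [u])" using g by (auto simp: cycle_in_def gu)
  ultimately have "pre_digraph.cycle ?G ?p"
    unfolding pre_digraph.cycle_def by auto
  moreover have "fst ` set ?p = {1..n}"
    using fst set by (metis list.set_map)
  ultimately show ?thesis
    unfolding maker_digraph_hamiltonian_def hamiltonian_def by (auto intro!: exI[of _ ?p])
qed

text \<open>Needed because positions of \<open>can_force\<close> may contain arcs that Maker did not
  plan.\<close>

lemma hamiltonian_mono:
  assumes "maker_digraph_hamiltonian n M" "M \<subseteq> M'"
  shows "maker_digraph_hamiltonian n M'"
proof -
  let ?G = "with_proj \<lparr>pverts = {1..n}, parcs = M\<rparr>" and ?G' = "with_proj \<lparr>pverts = {1..n}, parcs = M'\<rparr>"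
  obtain p u where p: "pre_digraph.awalk ?G u p u" "distinct (tl (pre_digraph.awalk_verts ?G u p))"
    "p \<noteq> []" "fst ` set p = {1..n}"
    using assms(1) unfolding maker_digraph_hamiltonian_def hamiltonian_def pre_digraph.cycle_def by auto
  have cas: "pre_digraph.cas ?G v q w = pre_digraph.cas ?G' v q w" for v q w
    by (induction q arbitrary: v) (simp_all add: pre_digraph.cas.simps)
  have verts: "pre_digraph.awalk_verts ?G v q = pre_digraph.awalk_verts ?G' v q" for v q
    by (simp add: pre_digraph.awalk_verts_conv)
  have "pre_digraph.awalk ?G' u p u"
    using p(1) assms(2) unfolding pre_digraph.awalk_def cas by auto
  then have "pre_digraph.cycle ?G' p"
    unfolding pre_digraph.cycle_def using p(2,3) verts by auto
  then show ?thesis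
    unfolding maker_digraph_hamiltonian_def hamiltonian_def using p(4) by auto
qed

lemma hamiltonian_has_out_arc:
  assumes "maker_digraph_hamiltonian n M" "v \<in> {1..n}"
  shows "\<exists>w. (v, w) \<in> M"
proof -
  let ?G = "with_proj \<lparr>pverts = {1..n}, parcs = M\<rparr>"
  obtain p u where p: "pre_digraph.awalk ?G u p u" "fst ` set p = {1..n}"
    using assms(1) unfolding maker_digraph_hamiltonian_def hamiltonian_def pre_digraph.cycle_def by auto
  have "set p \<subseteq> M" using p(1) unfolding pre_digraph.awalk_def by simp
  moreover obtain w where "(v, w) \<in> set p" using p(2) assms(2) by force
  ultimately show ?thesis by blast
qed

section \<open>Breaker's side\<close>

definition free_out :: "nat \<Rightarrow> (nat \<times> nat) set \<Rightarrow> nat \<Rightarrow> (nat \<times> nat) set" where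
  "free_out n B v = {e \<in> board n - B. fst e = v}"

text \<open>
  Breaker plays as BoxMaker on the disjoint out-stars. \<open>quota n c k\<close> bounds the number of free arcs in
  each of \<open>k\<close> stars untouched by Maker; it drops by \<open>c div k\<close> when Breaker spreads \<open>c\<close> arcs over them.
\<close>

definition quota :: "nat \<Rightarrow> nat \<Rightarrow> nat \<Rightarrow> nat" where
  "quota n c k = n - 1 - (\<Sum>i=k..c. c div i)"

lemma quota_step: "k \<ge> 1 \<Longrightarrow> quota n c (Suc k) - c div k \<le> quota n c k"
proof -
  assume "k \<ge> 1"
  have "(\<Sum>i=k..c. c div i) \<le> c div k + (\<Sum>i=Suc k..c. c div i)"
    by (cases "k \<le> c") (simp_all add: sum.atLeast_Suc_atMost)
  then show ?thesis by (simp add: quota_def)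
qed

lemma quota_le_Suc: "quota n c k \<le> quota n c (Suc k)"
  unfolding quota_def by (intro diff_le_mono2 sum_mono2) auto

text \<open>\<open>A\<close> collects stars that Maker has not entered. Entering one lowers
  \<open>card A\<close> by one, so the index \<open>Suc (card A)\<close> before Breaker's reply is
  the old \<open>card A\<close>. Since \<open>quota n c 1 = 0\<close>, the last such star has no
  free arc left and cannot be entered. The cap \<open>c\<close> replaces \<open>b\<close>, which may
  exceed the number of vertices; as \<open>c div k = 0\<close> for \<open>k > c\<close>, nothing is
  asked of Breaker until at most \<open>c\<close> stars are left.\<close>

lemma breaker_wins_if_quota:
  assumes n: "n \<ge> 1" and b: "b \<ge> 1" and c: "c \<le> b" "c < n" and q: "quota n c 1 = 0"
  shows "breaker_wins_hamiltonian n b"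
proof -
  define good where "good M B A k \<longleftrightarrow> A \<noteq> {} \<and> A \<subseteq> {1..n} \<and> (\<forall>v\<in>A. \<forall>w. (v, w) \<notin> M) \<and>
      (\<forall>v\<in>A. card (free_out n B v) \<le> quota n c k)"
    for M B :: "(nat \<times> nat) set" and A k
  define I where "I M B \<longleftrightarrow> (\<exists>A. good M B A (card A))" for M B
  define J where "J M B \<longleftrightarrow> (\<exists>A. good M B A (Suc (card A)))" for M B
  have fin: "finite (free_out n B v)" for B v
    by (simp add: free_out_def)
  show ?thesis
    unfolding breaker_wins_hamiltonian_def
  proof (rule breaker_wins_by_invariant[where I = I and J = J, OF finite_board b])
    have "card (free_out n {} v) \<le> n - 1" if "v \<in> {1..n}" for v
    proof -
      have "free_out n {} v = Pair v ` ({1..n} - {v})"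
        using that by (auto simp: free_out_def board_iff)
      then show ?thesis using that by (simp add: card_image inj_on_def)
    qed
    \<comment> \<open>The sum is empty because of \<open>c < n\<close>, so the quota starts at the
      full out-degree.\<close>
    moreover have "quota n c n = n - 1" using c by (simp add: quota_def)
    ultimately have "good {} {} {1..n} (card {1..n})" using n by (auto simp: good_def)
    then show "I {} {}" unfolding I_def by blast
  next
    fix M B e assume "I M B" and e: "e \<in> board n - M - B"
    then obtain A where A: "good M B A (card A)" unfolding I_def by blast
    then have finA: "finite A" by (auto simp: good_def intro: finite_subset)
    show "J (insert e M) B"
    proof (cases "fst e \<in> A")
      case False
      have "good (insert e M) B A (Suc (card A))"
        using A False quota_le_Suc[of n c "card A"] by (force simp: good_def)
      then show ?thesis unfolding J_def by blast
    next
      case True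
      have "e \<in> free_out n B (fst e)" using e by (auto simp: free_out_def)
      then have pos: "card (free_out n B (fst e)) > 0" using fin by (auto simp: card_gt_0_iff)
      then have "quota n c (card A) > 0" using A True by (auto simp: good_def)
      then have "card A \<noteq> 1" using q by auto
      moreover have "card A \<noteq> 0" using A finA by (auto simp: good_def)
      ultimately have "A - {fst e} \<noteq> {}" 
        by (metis True card.empty card_Suc_Diff1 finA One_nat_def)
      moreover have "Suc (card (A - {fst e})) = card A" by (rule card_Suc_Diff1[OF finA True])
      ultimately have "good (insert e M) B (A - {fst e}) (Suc (card (A - {fst e})))"
        using A by (auto simp: good_def)
      then show ?thesis unfolding J_def by blast
    qed
  next
    fix M B assume "J M B" and MB: "M \<union> B \<subseteq> board n" "M \<inter> B = {}"
    then obtain A where A: "good M B A (Suc (card A))" unfolding J_def by blast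
    then have finA: "finite A" by (auto simp: good_def intro: finite_subset)
    let ?k = "card A"
    have k: "?k \<ge> 1" using A finA by (auto simp: good_def Suc_le_eq card_gt_0_iff)
    have "\<exists>S \<subseteq> free_out n B v. card S = min (c div ?k) (card (free_out n B v))" for v
      by (meson min.cobounded2 obtain_subset_with_card_n)
    then obtain S where S: "\<And>v. S v \<subseteq> free_out n B v"
      "\<And>v. card (S v) = min (c div ?k) (card (free_out n B v))"
      by metis
    define R0 where "R0 = (\<Union>v\<in>A. S v)"
    have finS: "finite (S v)" for v using S(1) fin finite_subset by blast
    have "card R0 \<le> (\<Sum>v\<in>A. card (S v))"
      unfolding R0_def using card_UN_le[OF finA] by blast
    also have "\<dots> \<le> (\<Sum>v\<in>A. c div ?k)" by (rule sum_mono) (simp add: S)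
    also have "\<dots> = ?k * (c div ?k)" by simp
    also have "\<dots> \<le> c" by simp
    finally have card: "card R0 \<le> b" using c by simp
    have sub: "R0 \<subseteq> board n - M - B"
      using S(1) A unfolding R0_def free_out_def good_def by fastforce
    have "I M (B \<union> R)" if R: "R0 \<subseteq> R" "R \<subseteq> board n - M - B" for R
    proof -
      have "card (free_out n (B \<union> R) v) \<le> quota n c ?k" if v: "v \<in> A" for v
      proof -
        have "free_out n (B \<union> R) v \<subseteq> free_out n B v - S v"
          using R(1) v by (auto simp: free_out_def R0_def)
        then have "card (free_out n (B \<union> R) v) \<le> card (free_out n B v - S v)"
          using fin by (simp add: card_mono)
        also have "\<dots> = card (free_out n B v) - card (S v)"
          using S(1) finS by (simp add: card_Diff_subset)
        also have "\<dots> \<le> quota n c (Suc ?k) - c div ?k"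
          using S(2)[of v] A v by (auto simp: good_def)
        also have "\<dots> \<le> quota n c ?k" using quota_step[OF k] .
        finally show ?thesis .
      qed
      then have "good M (B \<union> R) A ?k" using A by (auto simp: good_def)
      then show ?thesis unfolding I_def by blast
    qed
    then show "\<exists>R0 \<subseteq> board n - M - B. card R0 \<le> b \<and>
        (\<forall>R. R0 \<subseteq> R \<longrightarrow> R \<subseteq> board n - M - B \<longrightarrow> I M (B \<union> R))"
      using card sub by blast
  next
    fix M B assume "I M B \<or> J M B"
    then obtain A k where "good M B A k" unfolding I_def J_def by blast
    then obtain v where "v \<in> {1..n}" "\<forall>w. (v, w) \<notin> M" unfolding good_def by blast
    then show "\<not> maker_digraph_hamiltonian n M" using hamiltonian_has_out_arc by blast
  qed
qed

section \<open>Harmonic sums and Breaker's threshold\<close>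

lemma ln_Suc_le_sum_inverse: "ln (real n + 1) \<le> (\<Sum>i=1..n. 1 / real i)"
proof (induction n)
  case (Suc n)
  have "real (Suc n) + 1 = (real n + 1) * (1 + 1 / real (Suc n))" by (simp add: field_simps)
  then have "ln (real (Suc n) + 1) = ln (real n + 1) + ln (1 + 1 / real (Suc n))"
    by (simp only:) (rule ln_mult_pos, auto intro: add_pos_nonneg)
  also have "ln (1 + 1 / real (Suc n)) \<le> 1 / real (Suc n)"
    by (rule ln_add_one_self_le_self) simp
  finally show ?case using Suc by simp
qed simp

text \<open>Each rounding loses less than 1, so the sum is at least \<open>c\<close> times the
  harmonic sum, minus \<open>c\<close>.\<close>

lemma sum_div_ge:
  assumes "c \<ge> 1"
  shows "real c * (ln (real c) - 1) \<le> real (\<Sum>i=1..c. c div i)"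
proof -
  have "real c * (ln (real c) - 1) \<le> real c * (ln (real c + 1) - 1)"
    using assms by (intro mult_left_mono diff_right_mono) auto
  also have "\<dots> \<le> real c * (\<Sum>i=1..c. 1 / real i) - real c"
    using mult_left_mono[OF ln_Suc_le_sum_inverse[of c], of "real c"] by (simp add: algebra_simps)
  also have "\<dots> = (\<Sum>i=1..c. real c / real i - 1)"
    by (simp add: sum_subtractf sum_distrib_left)
  also have "\<dots> \<le> (\<Sum>i=1..c. real (c div i))"
  proof (rule sum_mono)
    fix i assume "i \<in> {1..c}"
    then have "real c / real i < real (c div i) + 1"
      using floor_divide_of_nat_eq[of c i, where ?'a = real] by linarith
    then show "real c / real i - 1 \<le> real (c div i)" by simp
  qed
  finally show ?thesis by simp
qed

lemma breaker_side:
  assumes "\<epsilon> > (0::real)"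
  shows "\<exists>N::nat. \<forall>n\<ge>N. \<forall>b::nat. b \<ge> 1 \<longrightarrow>
           real b \<ge> (1 + \<epsilon>) * real n / ln (real n) \<longrightarrow> breaker_wins_hamiltonian n b"
proof -
  define x where "x n = (1 + \<epsilon>) * real n / ln (real n)" for n :: nat
  have "\<forall>\<^sub>F n::nat in sequentially. x n + 1 < real n"
    unfolding x_def using assms by real_asymp
  moreover have "\<forall>\<^sub>F n::nat in sequentially. x n \<ge> 1"
    unfolding x_def using assms by real_asymp
  \<comment> \<open>\<open>ln (x n) - 1\<close> is asymptotic to \<open>ln n\<close>, so the product
    is asymptotic to \<open>(1 + \<epsilon>) * n\<close>; this is where the \<epsilon> is
    spent.\<close>
  moreover have "\<forall>\<^sub>F n::nat in sequentially. real n \<le> x n * (ln (x n) - 1)"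
    unfolding x_def using assms by real_asymp
  moreover have "\<forall>\<^sub>F n::nat in sequentially. ln (x n) - 1 \<ge> 0"
    unfolding x_def using assms by real_asymp
  moreover have "\<forall>\<^sub>F n::nat in sequentially. n \<ge> 1" by (rule eventually_ge_at_top)
  ultimately have "\<forall>\<^sub>F n::nat in sequentially. \<forall>b::nat. b \<ge> 1 \<longrightarrow> real b \<ge> x n \<longrightarrow> breaker_wins_hamiltonian n b"
  proof eventually_elim
    case (elim n)
    \<comment> \<open>The smallest integer bias that the threshold admits; it serves every larger
      \<open>b\<close> as well.\<close>
    define c where "c = nat \<lceil>x n\<rceil>"
    have c: "x n \<le> real c" "real c < x n + 1" "c \<ge> 1"
      using elim(2) unfolding c_def by linarith+
    have "real n \<le> x n * (ln (x n) - 1)" by (rule elim)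
    also have "\<dots> \<le> real c * (ln (real c) - 1)"
      using c elim(2,4) by (intro mult_mono) auto
    also have "\<dots> \<le> real (\<Sum>i=1..c. c div i)" by (rule sum_div_ge[OF c(3)])
    finally have "n \<le> (\<Sum>i=1..c. c div i)" by (simp only: of_nat_le_iff)
    then have "quota n c 1 = 0" by (simp add: quota_def)
    moreover have "c < n" using c elim(1) by linarith
    moreover have "c \<le> b" if "real b \<ge> x n" for b using that unfolding c_def by linarith
    ultimately show ?case using breaker_wins_if_quota elim(5) by blast
  qed
  then show ?thesis unfolding x_def eventually_sequentially by blast
qed

section \<open>Rotations of directed paths\<close>

text \<open>
  A double rotation of a path with end \<open>y\<close> uses arcs \<open>y \<rightarrow> Q!(a+1)\<close> and \<open>Q!a \<rightarrow> w\<close> where \<open>w\<close> comes later: the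
  segment strictly after \<open>Q!a\<close> and before \<open>w\<close> is cut out and appended at the end. If the cut points \<open>a\<close> are used in
  descending order then each of them lies in the initial segment \<open>take k Q\<close> that is still intact,
  so that \<open>w\<close> always comes later and no cycle can be split off.
\<close>

inductive rotation :: "('a \<times> 'a) set \<Rightarrow> 'a list \<Rightarrow> nat \<Rightarrow> nat \<Rightarrow> 'a list \<Rightarrow> bool" for M Q h where
  base: "rotation M Q h h Q"
| lower: "rotation M Q h k R \<Longrightarrow> 0 < k' \<Longrightarrow> k' \<le> k \<Longrightarrow> rotation M Q h k' R"
| rotate: "rotation M Q h k R \<Longrightarrow> Suc a < k \<Longrightarrow> (last R, Q ! Suc a) \<in> M \<Longrightarrow>
    drop k R = T1 @ w # T2 \<Longrightarrow> T1 \<noteq> [] \<Longrightarrow> (Q ! a, w) \<in> M \<Longrightarrow>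
    rotation M Q h (Suc a) (take (Suc a) Q @ w # T2 @ drop (Suc a) (take k Q) @ T1)"

text \<open>With \<open>R = A @ S @ T1 @ w # T2\<close>, where \<open>A @ S\<close> is the intact
  prefix, the rotation moves \<open>w # T2\<close> in front of \<open>S @ T1\<close>. The two arcs
  link \<open>A\<close> to \<open>w\<close> and the old end to \<open>S\<close>; the new end is that
  of \<open>T1\<close>, the predecessor of \<open>w\<close> in \<open>R\<close>.\<close>

lemma rotation_path:
  assumes "rotation M Q h k R" "0 < h" "h \<le> length Q" "path_in M Q"
  shows "0 < k \<and> k \<le> h \<and> take k R = take k Q \<and> mset R = mset Q \<and> path_in M R"
  using assms
proof (induction rule: rotation.induct)
  case (lower k R k')
  then have IH: "0 < k \<and> k \<le> h \<and> take k R = take k Q \<and> mset R = mset Q \<and> path_in M R" by blast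
  have "take k' (take k R) = take k' (take k Q)" using IH by simp
  then have "take k' R = take k' Q" using lower(3) by (simp add: min.absorb1)
  then show ?case using IH lower(2,3) by simp
next
  case (rotate k R a T1 w T2)
  define A S where "A = take (Suc a) Q" and "S = drop (Suc a) (take k Q)"
  from rotate have IH: "k \<le> h" "take k R = take k Q" "mset R = mset Q" "path_in M R" by auto
  have R: "R = take k Q @ T1 @ w # T2"
    using append_take_drop_id[of k R] unfolding IH(2) rotate(4) by (rule sym)
  have tk: "take k Q = A @ S"
    using append_take_drop_id[of "Suc a" "take k Q"] rotate(2) by (simp add: A_def S_def)
  have len: "Suc a < length Q" using rotate IH by linarith
  have A: "A \<noteq> []" "last A = Q ! a" using len by (auto simp: A_def take_Suc_conv_app_nth)
  have S: "S \<noteq> []" "hd S = Q ! Suc a" using rotate(2) IH(1) rotate.prems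
    by (auto simp: S_def hd_drop_conv_nth)
  have lastR: "last R = last (w # T2)" by (simp add: R)
  have parts: "path_in M A" "path_in M S" "path_in M T1" "path_in M (w # T2)" "(last S, hd T1) \<in> M"
    using IH(4) S(1) rotate(5) unfolding R tk successively_append_iff by auto
  have "path_in M ((w # T2) @ (S @ T1))"
    unfolding successively_append_iff using parts rotate(3,5) S lastR by auto
  then have "path_in M (A @ w # T2 @ S @ T1)"
    unfolding successively_append_iff[of _ A] using parts rotate(6) A by auto
  moreover have "mset (A @ w # T2 @ S @ T1) = mset Q"
    unfolding IH(3)[symmetric] R tk by simp
  moreover have "take (Suc a) (A @ w # T2 @ S @ T1) = A" using len by (simp add: A_def)
  ultimately show ?case using rotate(2) IH(1) by (simp add: A_def S_def)
qed simp

text \<open>A cut in front of \<open>w\<close> separates no neighbours except those whose second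
  element is \<open>w\<close>.\<close>

lemma consecutive_in_append:
  assumes "xs @ w # ys = us @ x # y # vs" "y \<noteq> w"
  shows "(\<exists>vs'. xs = us @ x # y # vs') \<or> (\<exists>us'. w # ys = us' @ x # y # vs)"
proof -
  from assms(1) consider zs where "xs = us @ zs" "zs @ w # ys = x # y # vs"
    | zs where "us = xs @ zs" "w # ys = zs @ x # y # vs"
    by (auto simp: append_eq_append_conv2)
  then show ?thesis
  proof cases
    case 1
    show ?thesis
    proof (cases zs)
      case Nil
      then show ?thesis using 1 by (intro disjI2 exI[of _ "[]"]) simp
    next
      case (Cons z zs')
      then show ?thesis using 1 assms(2) by (cases zs') auto
    qed
  next
    case 2
    then show ?thesis by blast
  qed
qed

text \<open>Only a rotation with \<open>w = Q ! Suc b\<close> separates \<open>Q ! b\<close> from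
  its successor, and this very rotation makes \<open>Q ! b\<close> the end. Thus later arguments may
  refer to positions of the original \<open>Q\<close>, however scrambled \<open>R\<close> is by
  now.\<close>

lemma rotation_adjacent:
  assumes "rotation M Q h k R" "0 < h" "h \<le> length Q" "path_in M Q" "distinct Q"
    "h \<le> b" "Suc b < length Q"
  shows "(\<exists>T1 T2. drop k R = T1 @ Q ! b # Q ! Suc b # T2) \<or> (\<exists>R'. rotation M Q h k R' \<and> last R' = Q ! b)"
  using assms
proof (induction rule: rotation.induct)
  case base
  have "drop h Q = take (b - h) (drop h Q) @ drop b Q"
    using base by (metis append_take_drop_id drop_drop le_add_diff_inverse2)
  also have "drop b Q = Q ! b # Q ! Suc b # drop (Suc (Suc b)) Q"
    using base by (simp add: Cons_nth_drop_Suc)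
  finally show ?case by blast
next
  case (lower k R k')
  then consider T1 T2 where "drop k R = T1 @ Q ! b # Q ! Suc b # T2"
    | R' where "rotation M Q h k R'" "last R' = Q ! b" by blast
  then show ?case
  proof cases
    case 1
    have "drop k' R = take (k - k') (drop k' R) @ drop k R"
      using lower(3) by (metis append_take_drop_id drop_drop le_add_diff_inverse2)
    then have "drop k' R = (take (k - k') (drop k' R) @ T1) @ Q ! b # Q ! Suc b # T2"
      using 1 by simp
    then show ?thesis by blast
  next
    case 2
    then show ?thesis using rotation.lower lower(2,3) by blast
  qed
next
  case (rotate k R a T1 w T2)
  let ?R = "take (Suc a) Q @ w # T2 @ drop (Suc a) (take k Q) @ T1"
  have inv: "k \<le> h" "mset R = mset Q" using rotation_path[OF rotate(1)] rotate.prems by auto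
  have rot: "rotation M Q h (Suc a) ?R" using rotate by (intro rotation.rotate)
  have drop: "drop (Suc a) ?R = w # T2 @ drop (Suc a) (take k Q) @ T1"
    using rotate(2) inv rotate.prems by simp
  from rotate consider S1 S2 where "drop k R = S1 @ Q ! b # Q ! Suc b # S2"
    | R' where "rotation M Q h k R'" "last R' = Q ! b" by blast
  then show ?case
  proof cases
    case 1
    have dist: "distinct (drop k R)"
      using inv(2) rotate.prems by (metis distinct_drop mset_eq_imp_distinct_iff)
    show ?thesis
    proof (cases "Q ! Suc b = w")
      case True
      have "T1 @ w # T2 = (S1 @ [Q ! b]) @ w # S2" using 1 rotate(4) True by simp
      moreover have "w \<notin> set T1" "w \<notin> set T2" using dist unfolding rotate(4) by auto
      ultimately have "T1 = S1 @ [Q ! b]"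
        using append_Cons_eq_iff[of w T1 T2 "S1 @ [Q ! b]" S2] by blast
      then have "last ?R = Q ! b" by simp
      then show ?thesis using rot by blast
    next
      case False
      have "T1 @ w # T2 = S1 @ Q ! b # Q ! Suc b # S2" using 1 rotate(4) by simp
      from consecutive_in_append[OF this False]
      show ?thesis
      proof (elim disjE exE)
        fix vs' assume "T1 = S1 @ Q ! b # Q ! Suc b # vs'"
        then have "w # T2 @ drop (Suc a) (take k Q) @ T1 =
            (w # T2 @ drop (Suc a) (take k Q) @ S1) @ Q ! b # Q ! Suc b # vs'" by simp
        then show ?thesis unfolding drop by blast
      next
        fix us' assume "w # T2 = us' @ Q ! b # Q ! Suc b # S2"
        then have "w # T2 @ drop (Suc a) (take k Q) @ T1 =
            us' @ Q ! b # Q ! Suc b # (S2 @ drop (Suc a) (take k Q) @ T1)" 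
          by simp
        then show ?thesis unfolding drop by blast
      qed
    qed
  next
    case 2
    then show ?thesis using rotation.lower[of M Q h k R' "Suc a"] rotate(2) by auto
  qed
qed

text \<open>Either the pair is still adjacent and is cut now, or \<open>Q ! b\<close> has been an
  end before and lowering the index suffices.\<close>

lemma rotation_new_end:
  assumes "rotation M Q h k R" "0 < h" "h \<le> length Q" "path_in M Q" "distinct Q"
    "h \<le> b" "Suc b < length Q" "Suc a < k" "(last R, Q ! Suc a) \<in> M" "(Q ! a, Q ! Suc b) \<in> M"
  shows "\<exists>R'. rotation M Q h (Suc a) R' \<and> last R' = Q ! b"
  using rotation_adjacent[OF assms(1-7)]
proof (elim disjE exE conjE)
  fix T1 T2 assume "drop k R = T1 @ Q ! b # Q ! Suc b # T2"
  then have "drop k R = (T1 @ [Q ! b]) @ Q ! Suc b # T2" by simp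
  from rotation.rotate[OF assms(1,8,9) this _ assms(10)] show ?thesis by fastforce
next
  fix R' assume "rotation M Q h k R'" "last R' = Q ! b"
  then show ?thesis using rotation.lower[of M Q h k R' "Suc a"] assms(8) by auto
qed

text \<open>If both halves had at most \<open>\<sigma> - 1\<close> elements, the whole would have at
  most \<open>2 * \<sigma> - 2\<close>; so doubling up to one element is enough for one half to
  inherit the bound.\<close>

lemma halving:
  assumes fin: "\<And>t v. finite (A t v)"
    and S: "finite S" "card S = 2 ^ m" "\<sigma> \<le> card (\<Union>v\<in>S. A 0 v)"
    and grow: "\<And>t S'. t < m \<Longrightarrow> S' \<subseteq> S \<Longrightarrow> \<sigma> \<le> card (\<Union>v\<in>S'. A t v) \<Longrightarrow>
        2 * \<sigma> \<le> card (\<Union>v\<in>S'. A (Suc t) v) + 1"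
    and pos: "\<sigma> \<ge> (1::nat)"
  shows "\<exists>v\<in>S. \<sigma> \<le> card (A m v)"
proof -
  have "t \<le> m \<Longrightarrow> \<exists>S'\<subseteq>S. card S' = 2 ^ (m - t) \<and> \<sigma> \<le> card (\<Union>v\<in>S'. A t v)" for t
  proof (induction t)
    case (Suc t)
    then obtain S' where S': "S' \<subseteq> S" "card S' = 2 ^ (m - t)" "\<sigma> \<le> card (\<Union>v\<in>S'. A t v)" by auto
    have m: "m - t = Suc (m - Suc t)" using Suc by simp
    obtain S1 where S1: "S1 \<subseteq> S'" "card S1 = 2 ^ (m - Suc t)"
      using obtain_subset_with_card_n[of "2 ^ (m - Suc t)" S'] S'(2) unfolding m by auto
    have finS': "finite S'" using S' S(1) finite_subset by blast
    let ?S2 = "S' - S1" and ?A = "\<lambda>S. \<Union>v\<in>S. A (Suc t) v"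
    have S2: "card ?S2 = 2 ^ (m - Suc t)"
      using S1 S'(2) finS' m by (simp add: card_Diff_subset finite_subset)
    have "2 * \<sigma> \<le> card (?A S') + 1" using grow S' Suc by auto
    also have "?A S' = ?A S1 \<union> ?A ?S2" using S1 by auto
    also have "card (?A S1 \<union> ?A ?S2) \<le> card (?A S1) + card (?A ?S2)" by (rule card_Un_le)
    finally have "\<sigma> \<le> card (?A S1) \<or> \<sigma> \<le> card (?A ?S2)" by linarith
    then show ?case
    proof
      assume "\<sigma> \<le> card (?A S1)"
      then show ?thesis using S1 S'(1) by (intro exI[of _ S1]) auto
    next
      assume "\<sigma> \<le> card (?A ?S2)"
      then show ?thesis using S2 S'(1) by (intro exI[of _ ?S2]) auto
    qed
  qed (use S in auto)
  from this[of m] obtain S' where S': "S' \<subseteq> S" "card S' = 1" "\<sigma> \<le> card (\<Union>v\<in>S'. A m v)" by auto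
  then show ?thesis by (auto simp: card_1_singleton_iff)
qed

text \<open>The small side will hold cut points and the large side the far part of a path. Both
  directions occur: a double rotation uses an arc from a cut point into the far part, and the next
  one an arc from an end there to the successor of a new cut point.\<close>

definition hits :: "'a set \<Rightarrow> nat \<Rightarrow> nat \<Rightarrow> ('a \<times> 'a) set \<Rightarrow> bool" where
  "hits V s t M \<longleftrightarrow> (\<forall>A B. A \<subseteq> V \<longrightarrow> B \<subseteq> V \<longrightarrow> A \<inter> B = {} \<longrightarrow> card A = s \<longrightarrow> card B = t \<longrightarrow>
     M \<inter> A \<times> B \<noteq> {} \<and> M \<inter> B \<times> A \<noteq> {})"

lemma hits_mono:
  assumes "hits V s t M" "M \<subseteq> M'"
  shows "hits V s t M'"
  unfolding hits_def
proof (intro allI impI)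
  fix A B
  assume "A \<subseteq> V" "B \<subseteq> V" "A \<inter> B = {}" "card A = s" "card B = t"
  then have "M \<inter> A \<times> B \<noteq> {} \<and> M \<inter> B \<times> A \<noteq> {}"
    using assms(1) unfolding hits_def by simp
  then show "M' \<inter> A \<times> B \<noteq> {} \<and> M' \<inter> B \<times> A \<noteq> {}" using assms(2) by blast
qed

lemma hitsD:
  assumes "hits V s t M" "A \<subseteq> V" "B \<subseteq> V" "A \<inter> B = {}" "s \<le> card A" "t \<le> card B"
  shows "\<exists>a\<in>A. \<exists>b\<in>B. (a, b) \<in> M" "\<exists>a\<in>A. \<exists>b\<in>B. (b, a) \<in> M"
proof -
  obtain A' where A': "A' \<subseteq> A" "card A' = s" using assms(5) by (meson obtain_subset_with_card_n)
  obtain B' where B': "B' \<subseteq> B" "card B' = t" using assms(6) by (meson obtain_subset_with_card_n)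
  have "A' \<subseteq> V" "B' \<subseteq> V" "A' \<inter> B' = {}" using A' B' assms(2-4) by auto
  then have "M \<inter> A' \<times> B' \<noteq> {} \<and> M \<inter> B' \<times> A' \<noteq> {}"
    using assms(1) A'(2) B'(2) unfolding hits_def by simp
  then show "\<exists>a\<in>A. \<exists>b\<in>B. (a, b) \<in> M" "\<exists>a\<in>A. \<exists>b\<in>B. (b, a) \<in> M"
    using A'(1) B'(1) by blast+
qed

text \<open>The inserted arc is the first of the chain and the only one that Maker may still have to
  claim. Ends are recorded by their positions in \<open>Q\<close>.\<close>

definition new_ends :: "('a \<times> 'a) set \<Rightarrow> 'a list \<Rightarrow> nat \<Rightarrow> nat \<Rightarrow> nat set" where
  "new_ends M Q h v = {b \<in> {h..<length Q - 1}.
     \<exists>k R. rotation (insert (last Q, Q ! Suc v) M) Q h k R \<and> last R = Q ! b}"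

text \<open>
  The cut points in the first part of the path are taken from \<open>m\<close> consecutive windows of size \<open>3 s\<close>,
  going downwards. Sets of \<open>s\<close> cut points reach almost all of the second part and from there almost all
  of the next window, so that the set of initial points \<open>v\<close> can be halved in each window.
\<close>

lemma rotation_many_ends:
  assumes M: "path_in M Q" "distinct Q" "set Q \<subseteq> V" "hits V s t M" and s: "1 \<le> s"
    and h: "m * (3 * s) \<le> h0" "h < length Q" "2 * t + h \<le> length Q"
    and S: "S \<subseteq> {h0..<h - 1}" "card S = 2 ^ m" "s \<le> 2 ^ m"
  shows "\<exists>v\<in>S. length Q \<le> card (new_ends M Q h v) + t + h"
proof -
  define Z where "Z = {h..<length Q - 1}"
  \<comment> \<open>\<open>lo i\<close> is the lower edge of window \<open>i\<close>;
    \<open>slice 0\<close> holds the candidates for the first cut point. Below, \<open>A i v\<close>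
    are the cut points of slice \<open>i\<close> usable after the first arc given by
    \<open>v\<close>, and \<open>Y i v\<close> the ends reached while the prefix up to
    \<open>lo i\<close> is intact.\<close>
  define lo where "lo i = h0 - i * (3 * s)" for i
  define Mv where "Mv v = insert (last Q, Q ! Suc v) M" for v
  define slice where "slice i = (if i = 0 then {h0..<h - 1} else {lo i..<lo (i - 1)})" for i
  define A where "A i v = {a \<in> slice i. \<exists>k R. rotation (Mv v) Q h k R \<and> Suc a < k \<and>
      (last R, Q ! Suc a) \<in> Mv v}" for i v
  define Y where "Y i v = {b \<in> Z. \<exists>R. rotation (Mv v) Q h (Suc (lo i)) R \<and> last R = Q ! b}" for i v
  have "S \<noteq> {}" using S(2) by force
  then have hpos: "0 < h" "h0 < h" using S(1) by fastforce+
  have lo_le: "lo i \<le> h0" for i by (simp add: lo_def)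
  have slice_bounds: "lo i \<le> a" "Suc a < h" if "a \<in> slice i" for i a
  proof -
    have "lo i \<le> a \<and> (a < h - 1 \<or> a < h0)"
      using that lo_le[of i] lo_le[of "i - 1"] unfolding slice_def by (cases "i = 0") auto
    then show "lo i \<le> a" "Suc a < h" using hpos by linarith+
  qed
  have finA: "finite (A i v)" and finY: "finite (Y i v)" for i v
    by (simp_all add: A_def Y_def slice_def Z_def)
  have pathMv: "path_in (Mv v) Q" for v
    using path_in_mono[OF M(1), of "Mv v"] by (auto simp: Mv_def)
  have QV: "Q ! i \<in> V" if "i < length Q" for i using M(3) nth_mem[OF that] by blast
  have Qinj: "i = j" if "Q ! i = Q ! j" "i < length Q" "j < length Q" for i j
    using that M(2) by (simp add: nth_eq_iff_index_eq)
  have bounds: "Suc a < h \<and> Suc a < length Q" if "a \<in> slice i" for a i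
    using slice_bounds(2)[OF that] h(2) by linarith
  have step1: "b \<in> Y i v" if *: "a \<in> A i v" "b \<in> Z" "(Q ! a, Q ! Suc b) \<in> M" for i v a b
  proof -
    obtain k R where R: "rotation (Mv v) Q h k R" "Suc a < k" "(last R, Q ! Suc a) \<in> Mv v" "a \<in> slice i"
      using *(1) unfolding A_def by blast
    have "\<exists>R'. rotation (Mv v) Q h (Suc a) R' \<and> last R' = Q ! b"
      using R(2,3) * h hpos M(2) pathMv[of v]
      by (intro rotation_new_end[OF R(1)]) (auto simp: Z_def Mv_def)
    moreover have "Suc (lo i) \<le> Suc a" using slice_bounds R(4) by simp
    ultimately show ?thesis
      using that(2) rotation.lower[of "Mv v" Q h "Suc a" _ "Suc (lo i)"] by (auto simp: Y_def)
  qed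
  have step2: "a \<in> A (Suc i) v" if *: "b \<in> Y i v" "a \<in> slice (Suc i)" "(Q ! b, Q ! Suc a) \<in> M" for i v a b
  proof -
    obtain R where "rotation (Mv v) Q h (Suc (lo i)) R" "last R = Q ! b"
      using *(1) unfolding Y_def by blast
    moreover have "Suc a < Suc (lo i)" using *(2) by (simp add: slice_def)
    moreover have "(Q ! b, Q ! Suc a) \<in> Mv v" using *(3) by (simp add: Mv_def)
    ultimately show ?thesis using *(2) unfolding A_def by (metis (mono_tags, lifting) mem_Collect_eq)
  qed
  \<comment> \<open>Otherwise \<open>s\<close> cut points and the successors of \<open>t\<close>
    missed positions would contradict \<open>hits\<close>.\<close>
  have expand1: "card Z < card (\<Union>v\<in>S'. Y i v) + t"
    if "S' \<subseteq> S" "s \<le> card (\<Union>v\<in>S'. A i v)" for S' i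
  proof (rule ccontr)
    assume neg: "\<not> ?thesis"
    let ?A = "\<Union>v\<in>S'. A i v" and ?B = "Z - (\<Union>v\<in>S'. Y i v)"
    have bnd: "Suc a < h" "Suc a < length Q" if "a \<in> ?A" for a
      using that bounds unfolding A_def by blast+
    have bnd': "h \<le> b" "Suc b < length Q" if "b \<in> ?B" for b
      using that unfolding Z_def by auto
    have finU: "finite (\<Union>v\<in>S'. Y i v)" by (rule finite_subset[of _ Z]) (auto simp: Y_def Z_def)
    have "card Z - card (\<Union>v\<in>S'. Y i v) \<le> card ?B"
      by (rule diff_card_le_card_Diff[OF finU])
    then have "t \<le> card ?B" using neg by simp
    moreover have "inj_on ((!) Q) ?A"
      by (rule inj_onI, rule Qinj) (use bnd(2) Suc_lessD in blast)+
    moreover have "inj_on (\<lambda>b. Q ! Suc b) ?B"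
      by (rule inj_onI, rule Suc_inject, rule Qinj) (use bnd'(2) in blast)+
    ultimately have c: "s \<le> card ((!) Q ` ?A)" "t \<le> card ((\<lambda>b. Q ! Suc b) ` ?B)"
      using that by (simp_all add: card_image)
    have disj: "(!) Q ` ?A \<inter> (\<lambda>b. Q ! Suc b) ` ?B = {}"
    proof -
      have "Q ! a \<noteq> Q ! Suc b" if "a \<in> ?A" "b \<in> ?B" for a b
        using bnd[OF that(1)] bnd'[OF that(2)] Qinj[of a "Suc b"] by linarith
      then show ?thesis by blast
    qed
    have sub1: "(!) Q ` ?A \<subseteq> V" using bnd(2) QV Suc_lessD by blast
    have sub2: "(\<lambda>b. Q ! Suc b) ` ?B \<subseteq> V" using bnd'(2) QV by blast
    have "\<exists>x\<in>(!) Q ` ?A. \<exists>y\<in>(\<lambda>b. Q ! Suc b) ` ?B. (x, y) \<in> M"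
      by (rule hitsD(1)[OF M(4) sub1 sub2 disj c])
    then obtain a b where "a \<in> ?A" "b \<in> ?B" "(Q ! a, Q ! Suc b) \<in> M" by blast
    then show False using step1 by blast
  qed
  have lo_step: "lo i = lo (Suc i) + 3 * s" if "i < m" for i
  proof -
    have "Suc i * (3 * s) \<le> m * (3 * s)" using that by (intro mult_le_mono1) simp
    then show ?thesis using h(1) by (simp add: lo_def)
  qed
  \<comment> \<open>Fewer than \<open>s\<close> of the \<open>3 * s\<close> points of a window are
    missed, so more than \<open>2 * s\<close> are reached: the doubling that \<open>halving\<close>
    asks for.\<close>
  have expand2: "3 * s < card (\<Union>v\<in>S'. A (Suc i) v) + s"
    if "S' \<subseteq> S" "t \<le> card (\<Union>v\<in>S'. Y i v)" "i < m" for S' i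
  proof (rule ccontr)
    assume neg: "\<not> ?thesis"
    let ?A = "slice (Suc i) - (\<Union>v\<in>S'. A (Suc i) v)" and ?B = "\<Union>v\<in>S'. Y i v"
    have bnd: "Suc a < h" "Suc a < length Q" if "a \<in> ?A" for a
      using that bounds by blast+
    have bnd': "h \<le> b" "Suc b < length Q" if "b \<in> ?B" for b
      using that unfolding Y_def Z_def by auto
    have finU: "finite (\<Union>v\<in>S'. A (Suc i) v)"
      by (rule finite_subset[of _ "slice (Suc i)"]) (auto simp: A_def slice_def)
    have "card (slice (Suc i)) = 3 * s" using lo_step[OF \<open>i < m\<close>] by (simp add: slice_def)
    moreover have "card (slice (Suc i)) - card (\<Union>v\<in>S'. A (Suc i) v) \<le> card ?A"
      by (rule diff_card_le_card_Diff[OF finU])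
    ultimately have "s \<le> card ?A" using neg by simp
    moreover have "inj_on ((!) Q) ?B"
      by (rule inj_onI, rule Qinj) (use bnd'(2) Suc_lessD in blast)+
    moreover have "inj_on (\<lambda>a. Q ! Suc a) ?A"
      by (rule inj_onI, rule Suc_inject, rule Qinj) (use bnd(2) in blast)+
    ultimately have c: "s \<le> card ((\<lambda>a. Q ! Suc a) ` ?A)" "t \<le> card ((!) Q ` ?B)"
      using that by (simp_all add: card_image)
    have disj: "(\<lambda>a. Q ! Suc a) ` ?A \<inter> (!) Q ` ?B = {}"
    proof -
      have "Q ! Suc a \<noteq> Q ! b" if "a \<in> ?A" "b \<in> ?B" for a b
        using bnd[OF that(1)] bnd'[OF that(2)] Qinj[of "Suc a" b] by linarith
      then show ?thesis by blast
    qed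
    have sub1: "(\<lambda>a. Q ! Suc a) ` ?A \<subseteq> V" using bnd(2) QV by blast
    have sub2: "(!) Q ` ?B \<subseteq> V" using bnd'(2) QV Suc_lessD by blast
    have "\<exists>x\<in>(\<lambda>a. Q ! Suc a) ` ?A. \<exists>y\<in>(!) Q ` ?B. (y, x) \<in> M"
      by (rule hitsD(2)[OF M(4) sub1 sub2 disj c])
    then obtain a b where "a \<in> ?A" "b \<in> ?B" "(Q ! b, Q ! Suc a) \<in> M" by blast
    then show False using step2 by blast
  qed
  have cardZ: "card Z = length Q - 1 - h" by (simp add: Z_def)
  have "\<exists>v\<in>S. s \<le> card (A m v)"
  proof (rule halving[OF finA _ S(2) _ _ s])
    show "finite S" using S(2) by (simp add: card_ge_0_finite)
    then have "finite (\<Union>v\<in>S. A 0 v)" using finA by blast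
    \<comment> \<open>In \<open>slice 0\<close> every candidate is its own cut point, by the
      inserted arc alone.\<close>
    moreover have "S \<subseteq> (\<Union>v\<in>S. A 0 v)"
    proof
      fix v assume v: "v \<in> S"
      then have "v \<in> {h0..<h - 1}" using S(1) by blast
      then have "v \<in> A 0 v"
        by (auto simp: A_def slice_def Mv_def intro!: exI[of _ h] exI[of _ Q] rotation.base)
      then show "v \<in> (\<Union>v\<in>S. A 0 v)" using v by blast
    qed
    ultimately have "2 ^ m \<le> card (\<Union>v\<in>S. A 0 v)" using S(2) card_mono by metis
    then show "s \<le> card (\<Union>v\<in>S. A 0 v)" using S(3) by simp
  next
    fix i S' assume *: "i < m" "S' \<subseteq> S" "s \<le> card (\<Union>v\<in>S'. A i v)"
    then have "t \<le> card (\<Union>v\<in>S'. Y i v)" using expand1[of S' i] cardZ h by linarith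
    from expand2[OF *(2) this *(1)]
    show "2 * s \<le> card (\<Union>v\<in>S'. A (Suc i) v) + 1" by linarith
  qed
  then obtain v where v: "v \<in> S" "s \<le> card (A m v)" by blast
  have "card Z < card (Y m v) + t" using expand1[of "{v}" m] v by simp
  moreover have "card (Y m v) \<le> card (new_ends M Q h v)"
    by (rule card_mono) (auto simp: new_ends_def Y_def Z_def Mv_def)
  ultimately show ?thesis using v(1) cardZ h by (intro bexI[of _ v]) linarith+
qed

section \<open>Potentials\<close>

text \<open>
  In one round Breaker claims at most \<open>3 b\<close> arcs, each of which raises at most two levels by one. As
  \<open>2 powr x \<le> 1 + x\<close> on the unit interval, a round increases a sum of weights by at most its largest term.
\<close>

definition weight :: "nat \<Rightarrow> nat \<Rightarrow> real" where
  "weight b k = 2 powr (real k / (6 * real b))"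

lemma weight_pos [simp]: "0 < weight b k"
  and weight_nonneg [simp]: "0 \<le> weight b k"
  and weight_ge_1: "1 \<le> weight b k"
  and weight_0 [simp]: "weight b 0 = 1"
  by (simp_all add: weight_def ge_one_powr_ge_zero)

lemma weight_mono: "j \<le> k \<Longrightarrow> weight b j \<le> weight b k"
  by (simp add: weight_def divide_right_mono)

text \<open>Weighted inequality of arithmetic and geometric mean for the numbers 2 and 1.\<close>

lemma two_powr_le: "0 \<le> x \<Longrightarrow> x \<le> 1 \<Longrightarrow> 2 powr x \<le> 1 + (x::real)"
  using Youngs_inequality_0[of x "1 - x" 2 1] by simp

lemma weight_add_le:
  assumes "1 \<le> b" "k \<le> 6 * b"
  shows "weight b (j + k) \<le> weight b j * (1 + real k / (6 * real b))"
proof -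
  have "weight b (j + k) = weight b j * 2 powr (real k / (6 * real b))"
    by (simp add: weight_def add_divide_distrib powr_add)
  also have "\<dots> \<le> weight b j * (1 + real k / (6 * real b))"
    using assms by (intro mult_left_mono two_powr_le) (auto simp: divide_simps)
  finally show ?thesis .
qed

lemma weight_sum_le:
  assumes "1 \<le> b" "\<And>i. i \<in> I \<Longrightarrow> g i \<le> 6 * b" "\<And>i. i \<in> I \<Longrightarrow> weight b (f i) \<le> w"
  shows "(\<Sum>i\<in>I. weight b (f i + g i)) \<le> (\<Sum>i\<in>I. weight b (f i)) + w * real (\<Sum>i\<in>I. g i) / (6 * real b)"
proof -
  have "(\<Sum>i\<in>I. weight b (f i + g i)) \<le> (\<Sum>i\<in>I. weight b (f i) + w * real (g i) / (6 * real b))"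
  proof (rule sum_mono)
    fix i assume i: "i \<in> I"
    have "weight b (f i + g i) \<le> weight b (f i) * (1 + real (g i) / (6 * real b))"
      using assms i by (intro weight_add_le) auto
    also have "\<dots> = weight b (f i) + weight b (f i) * (real (g i) / (6 * real b))"
      by (simp add: algebra_simps)
    also have "\<dots> \<le> weight b (f i) + w * (real (g i) / (6 * real b))"
      using assms i by (intro add_left_mono mult_right_mono) auto
    finally show "weight b (f i + g i) \<le> weight b (f i) + w * real (g i) / (6 * real b)" by simp
  qed
  then show ?thesis by (simp add: sum.distrib sum_distrib_left sum_divide_distrib)
qed

section \<open>Levels of vertices and the danger of a set of boxes\<close>

definition out_count :: "('a \<times> 'a) set \<Rightarrow> 'a \<Rightarrow> nat" where
  "out_count B v = card {e \<in> B. fst e = v}"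

definition in_count :: "('a \<times> 'a) set \<Rightarrow> 'a \<Rightarrow> nat" where
  "in_count B v = card {e \<in> B. snd e = v}"

lemma count_split:
  assumes "finite B'" "B \<subseteq> B'"
  shows "out_count B' v = out_count B v + out_count (B' - B) v"
    and "in_count B' v = in_count B v + in_count (B' - B) v"
proof -
  have *: "card {e \<in> B'. P e} = card {e \<in> B. P e} + card {e \<in> B' - B. P e}" for P
  proof -
    have "{e \<in> B'. P e} = {e \<in> B. P e} \<union> {e \<in> B' - B. P e}" using assms(2) by auto
    also have "card \<dots> = card {e \<in> B. P e} + card {e \<in> B' - B. P e}"
      using assms finite_subset[OF assms(2,1)] by (intro card_Un_disjoint) auto
    finally show ?thesis .
  qed
  show "out_count B' v = out_count B v + out_count (B' - B) v"
    unfolding out_count_def by (rule *)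
  show "in_count B' v = in_count B v + in_count (B' - B) v"
    unfolding in_count_def by (rule *)
qed

lemma sum_fibres_le:
  assumes "finite N" "finite E"
  shows "(\<Sum>v\<in>E. card {e \<in> N. f e = v}) \<le> card N"
proof -
  have "(\<Sum>v\<in>E. card {e \<in> N. f e = v}) = card (\<Union>v\<in>E. {e \<in> N. f e = v})"
    using assms by (intro card_UN_disjoint[symmetric]) auto
  also have "\<dots> \<le> card N" using assms by (intro card_mono) auto
  finally show ?thesis .
qed

lemma sum_count_le:
  assumes "finite N" "finite E"
  shows "(\<Sum>v\<in>E. out_count N v) \<le> card N" "(\<Sum>v\<in>E. in_count N v) \<le> card N"
  unfolding out_count_def in_count_def using sum_fibres_le[OF assms] by blast+

lemma count_le_card:
  assumes "finite N"
  shows "out_count N v \<le> card N" "in_count N v \<le> card N"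
  unfolding out_count_def in_count_def using assms by (auto intro: card_mono)

lemma count_grow:
  assumes "finite B'" "B \<subseteq> B'" "card (B' - B) \<le> c"
  shows "out_count B' v \<le> out_count B v + c" "in_count B' v \<le> in_count B v + c"
  using count_split[OF assms(1,2), of v] count_le_card[of "B' - B" v] assms(1,3) by auto

text \<open>The boxes are the out-stars at \<open>E\<close> and the in-stars at \<open>S\<close>; a
  single arc lies in at most one box of each kind.\<close>

definition danger :: "nat \<Rightarrow> 'a set \<Rightarrow> 'a set \<Rightarrow> ('a \<times> 'a) set \<Rightarrow> real" where
  "danger b E S B = (\<Sum>v\<in>E. weight b (out_count B v)) + (\<Sum>v\<in>S. weight b (in_count B v))"

lemma danger_grow:
  assumes b: "1 \<le> b" "c \<le> 3 * b" and fin: "finite E" "finite S" "finite B'"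
    and B: "B \<subseteq> B'" "card (B' - B) \<le> c"
    and w: "\<And>v. v \<in> E \<Longrightarrow> weight b (out_count B v) \<le> w" "\<And>v. v \<in> S \<Longrightarrow> weight b (in_count B v) \<le> w" "0 \<le> w"
  shows "danger b E S B' \<le> danger b E S B + w"
proof -
  let ?N = "B' - B"
  have finN: "finite ?N" using fin by simp
  have "out_count ?N v \<le> 6 * b" "in_count ?N v \<le> 6 * b" for v
    using count_le_card[OF finN, of v] B b by linarith+
  then have "(\<Sum>v\<in>E. weight b (out_count B' v)) \<le>
      (\<Sum>v\<in>E. weight b (out_count B v)) + w * real (\<Sum>v\<in>E. out_count ?N v) / (6 * real b)"
    "(\<Sum>v\<in>S. weight b (in_count B' v)) \<le>
      (\<Sum>v\<in>S. weight b (in_count B v)) + w * real (\<Sum>v\<in>S. in_count ?N v) / (6 * real b)"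
    unfolding count_split[OF fin(3) B(1)] using w b by (intro weight_sum_le; simp)+
  \<comment> \<open>At most \<open>3 * b\<close> new arcs raise each of the two sums by at most
    \<open>w / 2\<close>; the factor 6 in \<open>weight\<close> is chosen for this.\<close>
  moreover have "w * real (\<Sum>v\<in>E. out_count ?N v) / (6 * real b) \<le> w * real (3 * b) / (6 * real b)"
    "w * real (\<Sum>v\<in>S. in_count ?N v) / (6 * real b) \<le> w * real (3 * b) / (6 * real b)"
    using sum_count_le[OF finN fin(1)] sum_count_le[OF finN fin(2)] B b w(3)
    by (intro divide_right_mono mult_left_mono of_nat_mono; linarith)+
  moreover have "w * real (3 * b) / (6 * real b) = w / 2" using b by simp
  ultimately show ?thesis unfolding danger_def by linarith
qed

lemma danger_level:
  assumes "finite E" "finite S"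
  shows "v \<in> E \<Longrightarrow> weight b (out_count B v) \<le> danger b E S B"
    and "v \<in> S \<Longrightarrow> weight b (in_count B v) \<le> danger b E S B"
proof -
  have nn: "0 \<le> (\<Sum>v\<in>E. weight b (out_count B v))" "0 \<le> (\<Sum>v\<in>S. weight b (in_count B v))"
    by (simp_all add: sum_nonneg less_imp_le)
  show "weight b (out_count B v) \<le> danger b E S B" if "v \<in> E"
    using member_le_sum[of v E "\<lambda>v. weight b (out_count B v)"] that assms nn
    unfolding danger_def by (simp add: less_imp_le)
  show "weight b (in_count B v) \<le> danger b E S B" if "v \<in> S"
    using member_le_sum[of v S "\<lambda>v. weight b (in_count B v)"] that assms nn
    unfolding danger_def by (simp add: less_imp_le)
qed

text \<open>A biased Erdos--Selfridge potential. Every unhit set contributes at least 1, so a value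
  below 1 certifies that all sets are hit.\<close>

definition unhit_weight :: "nat \<Rightarrow> 'a set set \<Rightarrow> 'a set \<Rightarrow> 'a set \<Rightarrow> real" where
  "unhit_weight b F M B = (\<Sum>A\<in>{A \<in> F. A \<inter> M = {}}. weight b (card (A \<inter> B)))"

lemma card_Int_split:
  assumes "finite B'" "B \<subseteq> B'"
  shows "card (A \<inter> B') = card (A \<inter> B) + card (A \<inter> (B' - B))"
proof -
  have "A \<inter> B' = (A \<inter> B) \<union> (A \<inter> (B' - B))" using assms by auto
  then show ?thesis
    using assms card_Un_disjoint[of "A \<inter> B" "A \<inter> (B' - B)"] finite_subset[OF assms(2,1)] by auto
qed

text \<open>A crude bound for the rounds in which Maker's move serves the path system instead of the
  potential.\<close>

lemma unhit_weight_double: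
  assumes "1 \<le> b" "finite F" "M \<subseteq> M'" "finite B'" "B \<subseteq> B'" "card (B' - B) \<le> b"
  shows "unhit_weight b F M' B' \<le> 2 * unhit_weight b F M B"
proof -
  have "unhit_weight b F M' B' \<le> (\<Sum>A\<in>{A \<in> F. A \<inter> M = {}}. weight b (card (A \<inter> B')))"
    unfolding unhit_weight_def using assms by (intro sum_mono2) (auto simp: less_imp_le)
  also have "\<dots> \<le> (\<Sum>A\<in>{A \<in> F. A \<inter> M = {}}. 2 * weight b (card (A \<inter> B)))"
  proof (rule sum_mono)
    fix A
    have "card (A \<inter> (B' - B)) \<le> b"
      using assms card_mono[of "B' - B" "A \<inter> (B' - B)"] by auto
    then have "card (A \<inter> (B' - B)) \<le> 6 * b" by simp
    from weight_add_le[OF assms(1) this, of "card (A \<inter> B)"]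
    have "weight b (card (A \<inter> B')) \<le> weight b (card (A \<inter> B)) * (1 + real (card (A \<inter> (B' - B))) / (6 * real b))"
      unfolding card_Int_split[OF assms(4,5), of A] .
    moreover have "real (card (A \<inter> (B' - B))) / (6 * real b) \<le> 1"
      using \<open>card (A \<inter> (B' - B)) \<le> 6 * b\<close> assms(1) by (simp add: divide_simps)
    then have "weight b (card (A \<inter> B)) * (1 + real (card (A \<inter> (B' - B))) / (6 * real b)) \<le>
        weight b (card (A \<inter> B)) * 2"
      by (intro mult_left_mono) auto
    ultimately show "weight b (card (A \<inter> B')) \<le> 2 * weight b (card (A \<inter> B))" by linarith
  qed
  finally show ?thesis by (simp add: unhit_weight_def sum_distrib_left)
qed

lemma unhit_weight_lt_1: "finite F \<Longrightarrow> unhit_weight b F M B < 1 \<Longrightarrow> A \<in> F \<Longrightarrow> A \<inter> M \<noteq> {}"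
proof
  assume *: "finite F" "unhit_weight b F M B < 1" "A \<in> F" "A \<inter> M = {}"
  then have "weight b (card (A \<inter> B)) \<le> unhit_weight b F M B"
    unfolding unhit_weight_def by (intro member_le_sum) (auto simp: less_imp_le)
  then show False using weight_ge_1[of b "card (A \<inter> B)"] *(2) by linarith
qed

text \<open>
  Beck's biased Erdos--Selfridge argument. The largest arc weight is at least the average one, which
  gives a definite decay per move instead of mere monotonicity.
\<close>

lemma unhit_weight_greedy:
  assumes b: "1 \<le> b" and fin: "finite F" "finite X"
    and F: "\<And>A. A \<in> F \<Longrightarrow> A \<subseteq> X \<and> 2 * l \<le> card A" and X: "card X \<le> N" "0 < N"
    and B: "B \<subseteq> X" "M \<inter> B = {}"
    and small: "unhit_weight b F M B < weight b l" "1 \<le> unhit_weight b F M B"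
  shows "\<exists>e\<in>X - B. \<forall>M' B'. insert e M \<subseteq> M' \<longrightarrow> B \<subseteq> B' \<longrightarrow> B' \<subseteq> X \<longrightarrow> card (B' - B) \<le> b \<longrightarrow>
    unhit_weight b F M' B' \<le> unhit_weight b F M B * (1 - real l / (2 * real N))"
proof -
  define G where "G = {A \<in> F. A \<inter> M = {}}"
  define p where "p A = weight b (card (A \<inter> B))" for A
  define W where "W e = (\<Sum>A\<in>{A \<in> G. e \<in> A}. p A)" for e
  let ?U = "unhit_weight b F M B"
  have finG: "finite G" using fin by (simp add: G_def)
  have U: "?U = sum p G" by (simp add: unhit_weight_def G_def p_def)
  have p_pos: "0 < p A" for A by (simp add: p_def)
  have finB: "finite B" using B fin finite_subset by blast
  have double_count: "(\<Sum>e\<in>C. W e) = (\<Sum>A\<in>G. p A * real (card (A \<inter> C)))" if "finite C" for C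
  proof -
    have "(\<Sum>e\<in>C. W e) = (\<Sum>e\<in>C. \<Sum>A\<in>G. if e \<in> A then p A else 0)"
      unfolding W_def using finG by (simp add: sum.If_cases Int_def)
    also have "\<dots> = (\<Sum>A\<in>G. \<Sum>e\<in>C. if e \<in> A then p A else 0)" by (rule sum.swap)
    also have "\<dots> = (\<Sum>A\<in>G. p A * real (card (A \<inter> C)))"
      using that by (simp add: sum.If_cases Int_def conj_commute mult.commute)
    finally show ?thesis .
  qed
  \<comment> \<open>\<open>l\<close> arcs of Breaker in one unhit set would already outweigh the
    whole potential, so at least \<open>l\<close> of its arcs are not his.\<close>
  have half: "l \<le> card (A \<inter> (X - B))" if "A \<in> G" for A
  proof -
    have A: "A \<in> F" using that by (simp add: G_def)
    have "p A \<le> sum p G" using that finG p_pos by (intro member_le_sum) (auto simp: less_imp_le)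
    then have "weight b (card (A \<inter> B)) < weight b l" using small U by (simp add: p_def)
    then have "card (A \<inter> B) < l" using weight_mono[of l "card (A \<inter> B)" b] by linarith
    moreover have "card A = card (A \<inter> B) + card (A \<inter> (X - B))"
      using card_Int_split[OF fin(2) B(1), of A] F[OF A] by (simp add: Int_absorb2)
    ultimately show ?thesis using F[OF A] by linarith
  qed
  have "?U * real l \<le> (\<Sum>e\<in>X - B. W e)"
    unfolding U sum_distrib_right double_count[OF finite_Diff[OF fin(2)]]
    using half p_pos by (intro sum_mono mult_left_mono) (auto simp: less_imp_le)
  have "X - B \<noteq> {}"
  proof
    assume "X - B = {}"
    have "l \<noteq> 0" using small by (intro notI) simp
    then have "G = {}" using half unfolding \<open>X - B = {}\<close> by fastforce
    then show False using U small by simp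
  qed
  then have "Max (W ` (X - B)) \<in> W ` (X - B)" using fin(2) by (intro Max_in) auto
  then obtain e where e: "e \<in> X - B" "W e = Max (W ` (X - B))" by auto
  have e_max: "W f \<le> W e" if "f \<in> X - B" for f
    using that fin(2) unfolding e(2) by (intro Max_ge) auto
  have W_nonneg: "0 \<le> W f" for f unfolding W_def using p_pos by (simp add: sum_nonneg less_imp_le)
  have "(\<Sum>e\<in>X - B. W e) \<le> real (card (X - B)) * W e"
    using e_max by (rule sum_bounded_above)
  also have "\<dots> \<le> real N * W e"
    using X fin W_nonneg card_mono[of X "X - B"] by (intro mult_right_mono) auto
  \<comment> \<open>The best arc carries at least the average share of the potential.\<close>
  finally have We: "?U * real l \<le> real N * W e"
    using \<open>?U * real l \<le> (\<Sum>e\<in>X - B. W e)\<close> by linarith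
  have "unhit_weight b F M' B' \<le> ?U * (1 - real l / (2 * real N))"
    if *: "insert e M \<subseteq> M'" "B \<subseteq> B'" "B' \<subseteq> X" "card (B' - B) \<le> b" for M' B'
  proof -
    let ?R = "B' - B"
    have finB': "finite B'" using * fin finite_subset by blast
    have le6: "card (A \<inter> ?R) \<le> 6 * b" for A
      using * card_mono[of ?R "A \<inter> ?R"] finB' by simp
    have "unhit_weight b F M' B' \<le> (\<Sum>A\<in>{A \<in> G. e \<notin> A}. weight b (card (A \<inter> B')))"
      unfolding unhit_weight_def using * fin
      by (intro sum_mono2) (auto simp: G_def less_imp_le)
    also have "\<dots> \<le> (\<Sum>A\<in>{A \<in> G. e \<notin> A}. p A + p A * real (card (A \<inter> ?R)) / (6 * real b))"
      using weight_add_le[OF b le6] unfolding card_Int_split[OF finB' *(2)] p_def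
      by (intro sum_mono) (simp add: algebra_simps)
    also have "\<dots> = (\<Sum>A\<in>{A \<in> G. e \<notin> A}. p A) + (\<Sum>A\<in>{A \<in> G. e \<notin> A}. p A * real (card (A \<inter> ?R)) / (6 * real b))"
      by (rule sum.distrib)
    also have "(\<Sum>A\<in>{A \<in> G. e \<notin> A}. p A) = ?U - W e"
    proof -
      have "G = {A \<in> G. e \<in> A} \<union> {A \<in> G. e \<notin> A}" by auto
      then have "sum p G = W e + (\<Sum>A\<in>{A \<in> G. e \<notin> A}. p A)"
        unfolding W_def using finG sum.union_disjoint[of "{A \<in> G. e \<in> A}" "{A \<in> G. e \<notin> A}" p] by auto
      then show ?thesis using U by simp
    qed
    also have "(\<Sum>A\<in>{A \<in> G. e \<notin> A}. p A * real (card (A \<inter> ?R)) / (6 * real b)) \<le>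
        (\<Sum>A\<in>G. p A * real (card (A \<inter> ?R)) / (6 * real b))"
      using finG p_pos by (intro sum_mono2) (auto simp: less_imp_le)
    also have "\<dots> = (\<Sum>f\<in>?R. W f) / (6 * real b)"
      using double_count[of ?R] finB' by (simp add: sum_divide_distrib)
    also have "(\<Sum>f\<in>?R. W f) \<le> real (card ?R) * W e"
      using e_max * by (intro sum_bounded_above) auto
    also have "real (card ?R) * W e / (6 * real b) \<le> real b * W e / (6 * real b)"
      using * W_nonneg[of e] by (intro divide_right_mono mult_right_mono) auto
    \<comment> \<open>Breaker's \<open>b\<close> arcs weigh at most \<open>W e\<close> each and win
      back at most a sixth of \<open>W e\<close>, so at least half of \<open>W e\<close> remains as
      net gain.\<close>
    finally have "unhit_weight b F M' B' \<le> ?U - W e + W e / 6"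
      using b by (simp add: divide_right_mono)
    moreover have "?U * real l / (2 * real N) \<le> W e / 2" using We X by (simp add: field_simps)
    moreover have "?U * (1 - real l / (2 * real N)) = ?U - ?U * real l / (2 * real N)"
      by (simp add: algebra_simps)
    ultimately show ?thesis using W_nonneg[of e] by linarith
  qed
  then show ?thesis using e(1) by blast
qed

section \<open>Absorbing paths into a cycle\<close>

text \<open>
  Rectangles of sides \<open>s\<close> and \<open>t\<close>, each with at least \<open>2 l\<close> arcs, have to be hit within \<open>T\<close> greedy moves;
  \<open>m\<close> is the number of windows in the halving argument; path ends of level at least \<open>\<theta>\<close> are
  treated as urgent, and \<open>K\<close> bounds the total danger.
\<close>

locale maker_parameters =
  fixes n b s t m l \<theta> T :: nat and K :: real
  assumes b: "1 \<le> b" "400 * b \<le> n"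
    and s: "1 \<le> s" "s \<le> 2 ^ m" "100 * 2 ^ m \<le> n" "96 * (m * s) \<le> n"
    and t: "24 * t \<le> n"
    and level: "\<And>k. weight b k \<le> 2 * K \<Longrightarrow> 100 * k \<le> n"
    and theta: "n \<le> 400 * \<theta>" "2 * real n * weight b (\<theta> + b) \<le> K"
    and time: "20000 * (b * (T + 5 * n)) \<le> n * n"
    and l: "2 * l \<le> s * t" "2 * 4 ^ n * 2 ^ n < weight b l"
      "2 * 4 ^ n * 2 ^ n * (1 - real l / (2 * real (n * n))) ^ T < 1"
begin

lemma n_ge: "400 \<le> n" using b by linarith

abbreviation force :: "(nat \<times> nat) set \<Rightarrow> (nat \<times> nat) set \<Rightarrow> bool" where
  "force \<equiv> can_force (board n) b (maker_digraph_hamiltonian n)"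

abbreviation position :: "(nat \<times> nat) set \<Rightarrow> (nat \<times> nat) set \<Rightarrow> bool" where
  "position M B \<equiv> M \<subseteq> board n \<and> B \<subseteq> board n \<and> M \<inter> B = {}"

lemma force_claim:
  assumes "position M B" "(u, v) \<in> board n" "(u, v) \<notin> B"
    and "\<And>M' B'. M \<subseteq> M' \<Longrightarrow> (u, v) \<in> M' \<Longrightarrow> B \<subseteq> B' \<Longrightarrow> card (B' - B) \<le> b \<Longrightarrow> position M' B' \<Longrightarrow> force M' B'"
  shows "force M B"
  using assms(2,3) by (rule can_force.claim) (rule assms(4), auto)

lemma finite_if_position: "position M B \<Longrightarrow> finite B"
  using finite_subset[OF _ finite_board] by blast

lemma card_diff_trans:
  assumes "B \<subseteq> B'" "B' \<subseteq> B''" "card (B' - B) \<le> i" "card (B'' - B') \<le> j"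
  shows "card (B'' - B) \<le> i + (j::nat)"
proof -
  have "B'' - B = (B' - B) \<union> (B'' - B')" using assms by blast
  then show ?thesis using card_Un_le[of "B' - B" "B'' - B'"] assms(3,4) by simp
qed

text \<open>Maker claims the first arc of the chain, Breaker replies, Maker closes the path from one
  of its new ends. The reply cannot break the chain, whose other arcs are Maker's; it can only block
  arcs into \<open>hd Q\<close>, hence the \<open>+ b\<close>. About \<open>n / 12\<close> ends face
  at most \<open>n / 50\<close> blocked ones.\<close>

lemma close_path:
  assumes pos: "position M B"
    and Q: "path_in M Q" "distinct Q" "set Q \<subseteq> {1..n}" "n \<le> 4 * length Q"
    and hit: "hits {1..n} s t M"
    and deg: "50 * out_count B (last Q) \<le> n" "50 * (in_count B (hd Q) + b) \<le> n"
    and cont: "\<And>M' B' R. M \<subseteq> M' \<Longrightarrow> B \<subseteq> B' \<Longrightarrow> card (B' - B) \<le> 2 * b \<Longrightarrow> position M' B' \<Longrightarrow>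
        cycle_in M' R \<Longrightarrow> set R = set Q \<Longrightarrow> force M' B'"
  shows "force M B"
proof -
  \<comment> \<open>The first quarter of the path holds the windows, the second the candidates for
    the first cut point, the second half the ends.\<close>
  define h h0 where "h = length Q div 2" and "h0 = length Q div 4"
  have len: "100 \<le> length Q" using Q(4) n_ge by linarith
  then have Qne: "Q \<noteq> []" by auto
  have hh: "4 * h0 \<le> length Q" "length Q \<le> 4 * h0 + 3" "2 * h \<le> length Q" "length Q \<le> 2 * h + 1"
    unfolding h_def h0_def by linarith+
  have finB: "finite B" by (rule finite_if_position[OF pos])
  have QV: "Q ! i \<in> {1..n}" if "i < length Q" for i using Q(3) nth_mem[OF that] by blast
  have Qinj: "i = j" if "Q ! i = Q ! j" "i < length Q" "j < length Q" for i j
    using that Q(2) by (simp add: nth_eq_iff_index_eq)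
  let ?blocked = "{v \<in> {h0..<h - 1}. (last Q, Q ! Suc v) \<in> B}"
  have "card ?blocked = card ((\<lambda>v. (last Q, Q ! Suc v)) ` ?blocked)"
  proof (rule card_image[symmetric], rule inj_onI)
    fix v w assume *: "v \<in> ?blocked" "w \<in> ?blocked" "(last Q, Q ! Suc v) = (last Q, Q ! Suc w)"
    then have "Suc v < length Q" "Suc w < length Q" using hh by auto
    then show "v = w" using Qinj[of "Suc v" "Suc w"] * by simp
  qed
  also have "\<dots> \<le> out_count B (last Q)"
    unfolding out_count_def using finB by (intro card_mono) auto
  finally have blocked: "card ?blocked \<le> out_count B (last Q)" .
  have "card ({h0..<h - 1} - ?blocked) = h - 1 - h0 - card ?blocked"
    by (subst card_Diff_subset) auto
  then have "2 ^ m \<le> card ({h0..<h - 1} - ?blocked)"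
    using hh blocked deg(1) Q(4) s(3) n_ge by linarith
  then obtain S where S: "S \<subseteq> {h0..<h - 1} - ?blocked" "card S = 2 ^ m"
    by (meson obtain_subset_with_card_n)
  have "m * (3 * s) \<le> h0" using hh Q(4) s(4) n_ge by simp
  moreover have "h < length Q" "2 * t + h \<le> length Q" using hh Q(4) t len n_ge by linarith+
  ultimately obtain v where v: "v \<in> S" "length Q \<le> card (new_ends M Q h v) + t + h"
    using rotation_many_ends[OF Q(1-3) hit s(1)] S s(2) by blast
  have vS: "v \<in> {h0..<h - 1}" "(last Q, Q ! Suc v) \<notin> B" using v(1) S(1) by auto
  have Sv: "Suc v < length Q - 1" using vS hh by auto
  have last: "last Q = Q ! (length Q - 1)" using Qne by (simp add: last_conv_nth)
  have "(last Q, Q ! Suc v) \<in> board n"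
    using QV[of "Suc v"] QV[of "length Q - 1"] Qinj[of "length Q - 1" "Suc v"] Sv len
    unfolding board_iff last by fastforce
  from pos this vS(2) show ?thesis
  proof (rule force_claim)
    fix M1 B1 assume 1: "M \<subseteq> M1" "(last Q, Q ! Suc v) \<in> M1" "B \<subseteq> B1" "card (B1 - B) \<le> b" "position M1 B1"
    have finB1: "finite B1" by (rule finite_if_position[OF 1(5)])
    let ?E = "new_ends M Q h v"
    let ?blocked = "{i \<in> ?E. (Q ! i, hd Q) \<in> B1}"
    have E_len: "i < length Q" if "i \<in> ?E" for i using that by (auto simp: new_ends_def)
    have "card ?blocked = card ((\<lambda>i. (Q ! i, hd Q)) ` ?blocked)"
    proof (rule card_image[symmetric], rule inj_onI)
      fix i j assume "i \<in> ?blocked" "j \<in> ?blocked" "(Q ! i, hd Q) = (Q ! j, hd Q)"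
      then show "i = j" using Qinj[of i j] E_len by simp
    qed
    also have "\<dots> \<le> in_count B1 (hd Q)"
      unfolding in_count_def using finB1 by (intro card_mono) auto
    also have "\<dots> \<le> in_count B (hd Q) + b" by (rule count_grow(2)[OF finB1 1(3,4)])
    finally have "50 * card ?blocked \<le> 50 * (in_count B (hd Q) + b)" by (rule mult_le_mono2)
    then have "50 * card ?blocked \<le> n" using deg(2) by (rule order_trans)
    moreover have "length Q \<le> 2 * card ?E + 2 * t + 1" using v(2) hh by linarith
    ultimately have "card ?blocked < card ?E" using Q(4) t n_ge by linarith
    then have "?blocked \<noteq> ?E" by (metis order_less_irrefl)
    then obtain i where i: "i \<in> ?E" "(Q ! i, hd Q) \<notin> B1" by blast
    then obtain k R where R: "rotation (insert (last Q, Q ! Suc v) M) Q h k R" "last R = Q ! i" "h \<le> i"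
      unfolding new_ends_def by auto
    have pathQ: "path_in (insert (last Q, Q ! Suc v) M) Q" by (rule path_in_mono[OF Q(1)]) auto
    have hpos: "0 < h" "h \<le> length Q" using hh len by linarith+
    have inv: "0 < k" "take k R = take k Q" "mset R = mset Q"
      and pathR: "path_in (insert (last Q, Q ! Suc v) M) R"
      using rotation_path[OF R(1) hpos pathQ] by auto
    have setR: "set R = set Q" using inv(3) by (metis set_mset_mset)
    have distR: "distinct R" using inv(3) Q(2) by (metis mset_eq_imp_distinct_iff)
    have Rne: "R \<noteq> []" using setR Qne by auto
    \<comment> \<open>The intact prefix is never empty, so rotations keep the start of the
      path.\<close>
    have hdR: "hd R = hd Q" using inv(1,2) by (metis hd_take)
    have "(Q ! i, hd Q) \<in> board n"
      using QV[of i] QV[of 0] Qinj[of i 0] E_len[OF i(1)] R(3) hpos len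
      unfolding board_iff hd_conv_nth[OF Qne] by fastforce
    from 1(5) this i(2) show "force M1 B1"
    proof (rule force_claim)
      fix M2 B2 assume 2: "M1 \<subseteq> M2" "(Q ! i, hd Q) \<in> M2" "B1 \<subseteq> B2" "card (B2 - B1) \<le> b" "position M2 B2"
      have "path_in M2 R" by (rule path_in_mono[OF pathR]) (use 1 2 in auto)
      then have "cycle_in M2 R"
        unfolding cycle_in_def using Rne distR hdR R(2) 2(2) by simp
      moreover have "card (B2 - B) \<le> 2 * b"
        using card_diff_trans[OF 1(3) 2(3) 1(4) 2(4)] by simp
      moreover have "M \<subseteq> M2" "B \<subseteq> B2" using 1 2 by auto
      ultimately show "force M2 B2" by (intro cont[OF _ _ _ 2(5) _ setR])
    qed
  qed
qed

section \<open>Systems of vertex-disjoint paths\<close>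

definition path_system :: "(nat \<times> nat) set \<Rightarrow> nat list set \<Rightarrow> bool" where
  "path_system M P \<longleftrightarrow> finite P \<and> (\<forall>p\<in>P. p \<noteq> [] \<and> distinct p \<and> path_in M p) \<and>
     (\<forall>p\<in>P. \<forall>q\<in>P. p \<noteq> q \<longrightarrow> set p \<inter> set q = {})"

lemma path_system_mono:
  assumes "path_system M P" "M \<subseteq> M'"
  shows "path_system M' P"
proof -
  have "path_in M' p" if "p \<in> P" for p
    using path_in_mono[OF _ assms(2), of p] assms(1) that by (simp add: path_system_def)
  then show ?thesis using assms(1) by (simp add: path_system_def)
qed

lemma path_system_subset:
  assumes "path_system M P" "P' \<subseteq> P"
  shows "path_system M P'"
proof -
  have "finite P'" using assms by (meson finite_subset path_system_def)
  then show ?thesis using assms unfolding path_system_def by (simp add: subset_iff)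
qed

lemma path_system_disjoint:
  "path_system M P \<Longrightarrow> p \<in> P \<Longrightarrow> q \<in> P \<Longrightarrow> p \<noteq> q \<Longrightarrow> set p \<inter> set q = {}"
  by (simp add: path_system_def)

lemma path_system_eq:
  assumes "path_system M P" "p \<in> P" "q \<in> P" "x \<in> set p" "x \<in> set q"
  shows "p = q"
proof (rule ccontr)
  assume "p \<noteq> q"
  then have "set p \<inter> set q = {}" using assms(1-3) by (simp add: path_system_def)
  then show False using assms(4,5) by auto
qed

lemma path_system_inj:
  assumes "path_system M P"
  shows "inj_on last P" "inj_on hd P"
proof -
  have ne: "p \<noteq> []" if "p \<in> P" for p using assms that by (simp add: path_system_def)
  show "inj_on last P"
  proof (rule inj_onI)
    fix p q assume "p \<in> P" "q \<in> P" "last p = last q"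
    then show "p = q" using path_system_eq[OF assms, of p q "last p"] ne by (metis last_in_set)
  qed
  show "inj_on hd P"
  proof (rule inj_onI)
    fix p q assume "p \<in> P" "q \<in> P" "hd p = hd q"
    then show "p = q" using path_system_eq[OF assms, of p q "hd p"] ne by (metis hd_in_set)
  qed
qed

abbreviation box_danger :: "nat list set \<Rightarrow> (nat \<times> nat) set \<Rightarrow> real" where
  "box_danger P B \<equiv> danger b (last ` P) (hd ` P) B"

lemma cycle_in_rotate1: "cycle_in M g \<Longrightarrow> cycle_in M (rotate1 g)"
proof (cases g)
  case (Cons x xs)
  assume "cycle_in M g"
  then show ?thesis
    unfolding Cons cycle_in_def
    by (cases "xs = []") (simp_all add: successively_append_iff successively_Cons)
qed (simp add: cycle_in_def)

lemma cycle_in_rotate: "cycle_in M g \<Longrightarrow> cycle_in M (rotate i g)"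
  by (induction i) (simp_all add: cycle_in_rotate1)

lemma few_high_in_count:
  assumes "finite B" "\<And>v. v \<in> H \<Longrightarrow> n < 100 * in_count B v" "finite H"
  shows "n * card H \<le> 100 * card B"
proof -
  have "n * card H = (\<Sum>v\<in>H. n)" by simp
  also have "\<dots> \<le> (\<Sum>v\<in>H. 100 * in_count B v)"
    using assms(2) by (intro sum_mono) (simp add: less_imp_le)
  also have "\<dots> = 100 * (\<Sum>v\<in>H. in_count B v)" by (simp add: sum_distrib_left)
  also have "\<dots> \<le> 100 * card B" using sum_count_le(2)[OF assms(1,3)] by simp
  finally show ?thesis .
qed

text \<open>The opened cycle followed by \<open>p\<close> has to be closed again at
  \<open>hd g'\<close>, so not only must the arc to \<open>x\<close> be free but
  \<open>hd g'\<close> must also have a small in-count. These conditions exclude at most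
  \<open>n / 100\<close> and \<open>n / 200\<close> of the at least \<open>n / 4\<close>
  places.\<close>

lemma find_insertion_point:
  assumes pos: "position M B" and g: "cycle_in M g" "n \<le> 4 * length g"
    and x: "100 * in_count B x \<le> n" and B: "20000 * card B \<le> n * n"
  shows "\<exists>g'. cycle_in M g' \<and> set g' = set g \<and> length g' = length g \<and>
    (last g', x) \<notin> B \<and> 100 * in_count B (hd g') \<le> n"
proof -
  let ?l = "length g"
  have dist: "distinct g" and gne: "g \<noteq> []" using g by (auto simp: cycle_in_def)
  then have l: "0 < ?l" by simp
  have finB: "finite B" by (rule finite_if_position[OF pos])
  have last: "last (rotate (Suc j) g) = g ! j" if "j < ?l" for j
  proof -
    have "last (rotate (Suc j) g) = rotate (Suc j) g ! (?l - 1)"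
      using gne by (subst last_conv_nth) (auto simp del: rotate_Suc)
    also have "\<dots> = g ! ((Suc j + (?l - 1)) mod ?l)"
      using l by (intro nth_rotate) simp
    also have "Suc j + (?l - 1) = j + ?l" using l by simp
    finally show ?thesis using that by simp
  qed
  define nxt where "nxt j = hd (rotate (Suc j) g)" for j
  have hd: "nxt j = g ! (if Suc j = ?l then 0 else Suc j)" if "j < ?l" for j
    unfolding nxt_def using gne that by (subst hd_rotate_conv_nth) (auto simp: mod_Suc)
  let ?b1 = "{j \<in> {..<?l}. (g ! j, x) \<in> B}"
  let ?b2 = "{j \<in> {..<?l}. n < 100 * in_count B (nxt j)}"
  have "card ?b1 = card ((\<lambda>j. (g ! j, x)) ` ?b1)"
    by (rule card_image[symmetric]) (auto simp: inj_on_def nth_eq_iff_index_eq[OF dist])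
  also have "\<dots> \<le> in_count B x" unfolding in_count_def using finB by (intro card_mono) auto
  finally have b1: "card ?b1 \<le> in_count B x" .
  have "inj_on nxt ?b2"
  proof (rule inj_onI)
    fix i j assume *: "i \<in> ?b2" "j \<in> ?b2" "nxt i = nxt j"
    then have ij: "i < ?l" "j < ?l" by auto
    then have "(if Suc i = ?l then 0 else Suc i) = (if Suc j = ?l then 0 else Suc j)"
      using *(3) l unfolding hd[OF ij(1)] hd[OF ij(2)]
      by (subst (asm) nth_eq_iff_index_eq[OF dist]) auto
    then show "i = j" by (auto split: if_splits)
  qed
  then have "card (nxt ` ?b2) = card ?b2" by (rule card_image)
  moreover have "n * card (nxt ` ?b2) \<le> 100 * card B"
    by (rule few_high_in_count[OF finB]) auto
  ultimately have "n * card ?b2 \<le> 100 * card B" by (simp only:)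
  then have "200 * (n * card ?b2) \<le> n * n" using B by linarith
  then have "n * (200 * card ?b2) \<le> n * n" by (simp add: mult.left_commute)
  then have b2: "200 * card ?b2 \<le> n" using n_ge by simp
  have "card (?b1 \<union> ?b2) \<le> card ?b1 + card ?b2" by (rule card_Un_le)
  also have "\<dots> < ?l" using b1 b2 x g(2) n_ge by linarith
  finally have "?b1 \<union> ?b2 \<noteq> {..<?l}" by (metis card_lessThan order_less_irrefl)
  moreover have "?b1 \<union> ?b2 \<subseteq> {..<?l}" by auto
  ultimately obtain j where "j < ?l" "j \<notin> ?b1" "j \<notin> ?b2" by blast
  then have j: "j < ?l" "(g ! j, x) \<notin> B" "100 * in_count B (hd (rotate (Suc j) g)) \<le> n"
    by (simp_all add: nxt_def not_less del: rotate_Suc)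
  show ?thesis
    using j last[OF j(1)] cycle_in_rotate[OF g(1), of "Suc j"]
    by (intro exI[of _ "rotate (Suc j) g"]) (simp del: rotate_Suc)
qed

text \<open>The path with the heaviest loose side is absorbed first. Its weight \<open>w p\<close>
  leaves the sum, and three replies raise the remaining sum by at most \<open>w p\<close>, so
  \<open>box_danger\<close> never grows. The last hypothesis reserves \<open>3 * b\<close> arcs for
  every path still outside the cycle, which keeps \<open>find_insertion_point\<close>
  applicable.\<close>

lemma absorb_paths:
  assumes "position M B" "cycle_in M g" "n \<le> 4 * length g" "path_system M P"
    and "set g \<union> (\<Union>p\<in>P. set p) = {1..n}" "\<And>p. p \<in> P \<Longrightarrow> set g \<inter> set p = {}"
    and "hits {1..n} s t M" "box_danger P B \<le> 2 * K"
    and "20000 * (card B + 3 * b * card P) \<le> n * n"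
  shows "force M B"
  using assms
proof (induction "card P" arbitrary: M B g P)
  case 0
  then have "P = {}" by (simp add: path_system_def)
  then show ?case using 0 by (intro can_force.reached hamiltonian_if_cycle_in[of _ g]) auto
next
  case (Suc c)
  note pos = Suc.prems(1) and sys = Suc.prems(4)
  have finP: "finite P" using sys by (simp add: path_system_def)
  have Pne: "P \<noteq> {}" using Suc.hyps(2) by auto
  have finB: "finite B" by (rule finite_if_position[OF pos])
  define w where "w p = max (weight b (out_count B (last p))) (weight b (in_count B (hd p)))" for p :: "nat list"
  have "Max (w ` P) \<in> w ` P" using finP Pne by (intro Max_in) auto
  then obtain p where p: "p \<in> P" "w p = Max (w ` P)" by auto
  have w_max: "w q \<le> w p" if "q \<in> P" for q
    using that finP unfolding p(2) by (intro Max_ge) auto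
  have pP: "p \<noteq> []" "distinct p" "path_in M p" using sys p(1) by (auto simp: path_system_def)
  have fin: "finite (last ` P)" "finite (hd ` P)" using finP by auto
  have "weight b (out_count B (last p)) \<le> 2 * K" "weight b (in_count B (hd p)) \<le> 2 * K"
    using danger_level(1)[OF fin, of "last p" b B] danger_level(2)[OF fin, of "hd p" b B] p(1) Suc.prems(8)
    by (auto intro: order_trans)
  then have deg: "100 * out_count B (last p) \<le> n" "100 * in_count B (hd p) \<le> n"
    using level by blast+
  obtain g' where g': "cycle_in M g'" "set g' = set g" "length g' = length g" "(last g', hd p) \<notin> B"
    "100 * in_count B (hd g') \<le> n"
    using find_insertion_point[OF pos Suc.prems(2,3) deg(2)] Suc.prems(9) by auto
  have g'ne: "g' \<noteq> []" "distinct g'" "path_in M g'" using g'(1) by (auto simp: cycle_in_def)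
  have disj: "set g' \<inter> set p = {}" using Suc.prems(6)[OF p(1)] g'(2) by simp
  have ends: "last g' \<in> set g'" "hd p \<in> set p" using g'ne pP by simp_all
  have "set g' \<subseteq> {1..n}" unfolding Suc.prems(5)[symmetric] g'(2) by (rule Un_upper1)
  have "set p \<subseteq> {1..n}" unfolding Suc.prems(5)[symmetric] using p(1) by (intro le_supI2 UN_upper)
  have "last g' \<noteq> hd p" using ends disj by (metis disjoint_iff)
  then have "(last g', hd p) \<in> board n"
    using ends \<open>set g' \<subseteq> {1..n}\<close> \<open>set p \<subseteq> {1..n}\<close> unfolding board_iff by (metis subsetD)
  from pos this g'(4) show ?case
  proof (rule force_claim)
    fix M1 B1 assume 1: "M \<subseteq> M1" "(last g', hd p) \<in> M1" "B \<subseteq> B1" "card (B1 - B) \<le> b" "position M1 B1"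
    let ?Q = "g' @ p"
    have finB1: "finite B1" by (rule finite_if_position[OF 1(5)])
    have path: "path_in M1 ?Q"
      using path_in_mono[OF g'ne(3) 1(1)] path_in_mono[OF pP(3) 1(1)] 1(2)
      by (simp add: successively_append_iff)
    have "out_count B1 (last p) \<le> out_count B (last p) + b" "in_count B1 (hd g') \<le> in_count B (hd g') + b"
      using count_grow[OF finB1 1(3,4)] by auto
    then have "50 * out_count B1 (last ?Q) \<le> n" "50 * (in_count B1 (hd ?Q) + b) \<le> n"
      using deg g'(5) b(2) pP(1) g'ne(1) by simp_all
    moreover have "distinct ?Q" "set ?Q \<subseteq> {1..n}" "n \<le> 4 * length ?Q"
      using g'ne pP disj \<open>set g' \<subseteq> {1..n}\<close> \<open>set p \<subseteq> {1..n}\<close> g'(3) Suc.prems(3) by simp_all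
    ultimately show "force M1 B1"
      using 1(5) path hits_mono[OF Suc.prems(7) 1(1)]
    proof (intro close_path[of M1 B1 ?Q])
      fix M2 B2 R assume 2: "M1 \<subseteq> M2" "B1 \<subseteq> B2" "card (B2 - B1) \<le> 2 * b" "position M2 B2"
        "cycle_in M2 R" "set R = set ?Q"
      let ?P = "P - {p}"
      have finB2: "finite B2" by (rule finite_if_position[OF 2(4)])
      have sub: "M \<subseteq> M2" "B \<subseteq> B2" using 1 2 by auto
      have new: "card (B2 - B) \<le> 3 * b"
        using card_diff_trans[OF 1(3) 2(2) 1(4) 2(3)] by simp
      have "length R = length ?Q"
        using 2(5,6) \<open>distinct ?Q\<close> distinct_card[of R] distinct_card[of ?Q] by (simp add: cycle_in_def)
      then have "n \<le> 4 * length R" using \<open>n \<le> 4 * length ?Q\<close> by simp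
      moreover have "path_system M2 ?P"
        by (rule path_system_subset[OF path_system_mono[OF sys sub(1)]]) auto
      moreover have "set R \<union> (\<Union>q\<in>?P. set q) = {1..n}"
      proof -
        have "(\<Union>q\<in>P. set q) = set p \<union> (\<Union>q\<in>?P. set q)" using p(1) by blast
        then show ?thesis using Suc.prems(5) unfolding 2(6) set_append g'(2) by (simp add: Un_assoc)
      qed
      moreover have "set R \<inter> set q = {}" if "q \<in> ?P" for q
      proof -
        have "set p \<inter> set q = {}" using path_system_disjoint[OF sys p(1), of q] that by blast
        moreover have "set g \<inter> set q = {}" using Suc.prems(6)[of q] that by simp
        ultimately show ?thesis unfolding 2(6) set_append g'(2) by (simp add: Int_Un_distrib2)
      qed
      moreover have "hits {1..n} s t M2" by (rule hits_mono[OF Suc.prems(7) sub(1)])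
      moreover have "box_danger ?P B2 \<le> 2 * K"
      proof -
        have img: "last ` ?P = last ` P - {last p}" "hd ` ?P = hd ` P - {hd p}"
          using inj_on_image_set_diff[OF path_system_inj(1)[OF sys], of P "{p}"]
            inj_on_image_set_diff[OF path_system_inj(2)[OF sys], of P "{p}"] p(1) by auto
        have "box_danger ?P B2 \<le> box_danger ?P B + w p"
        proof (rule danger_grow[OF b(1) order_refl _ _ finB2 sub(2) new])
          fix v assume "v \<in> last ` ?P"
          then obtain q where "q \<in> P" "v = last q" by blast
          then show "weight b (out_count B v) \<le> w p" using w_max[of q] by (simp add: w_def[of q])
        next
          fix v assume "v \<in> hd ` ?P"
          then obtain q where "q \<in> P" "v = hd q" by blast
          then show "weight b (in_count B v) \<le> w p" using w_max[of q] by (simp add: w_def[of q])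
        next
          show "0 \<le> w p" unfolding w_def using weight_nonneg[of b] by (simp add: max_def)
        qed (use finP in simp_all)
        also have "w p \<le> weight b (out_count B (last p)) + weight b (in_count B (hd p))"
          by (simp add: w_def)
        also have "box_danger ?P B + (weight b (out_count B (last p)) + weight b (in_count B (hd p))) =
            box_danger P B"
          unfolding danger_def img
          using sum.remove[OF fin(1), of "last p" "\<lambda>v. weight b (out_count B v)"]
            sum.remove[OF fin(2), of "hd p" "\<lambda>v. weight b (in_count B v)"] p(1) by simp
        finally show ?thesis using Suc.prems(8) by simp
      qed
      moreover have "card ?P = c" using Suc.hyps(2) p(1) finP by simp
      moreover have "card B2 = card B + card (B2 - B)"
        using sub(2) finB finB2 by (metis card_Diff_subset card_mono le_add_diff_inverse)
      then have "card B2 + 3 * b * c \<le> card B + 3 * b * card P"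
        using new Suc.hyps(2) by (simp flip: Suc.hyps(2))
      ultimately show "force M2 B2"
        using 2(4,5) Suc.prems(9) by (intro Suc.hyps(1)[of ?P M2 B2 R]) auto
    qed auto
  qed
qed

end

section \<open>Merging paths and building the pseudorandom digraph\<close>

context maker_parameters
begin

text \<open>A linear counterpart of \<open>box_danger\<close>: a new arc raises it by at most two
  and a forced merge lowers it by at least \<open>\<theta>\<close>.\<close>

definition levels :: "nat list set \<Rightarrow> (nat \<times> nat) set \<Rightarrow> nat" where
  "levels P B = (\<Sum>v\<in>last ` P. out_count B v) + (\<Sum>v\<in>hd ` P. in_count B v)"

text \<open>The last conjunct bounds the number \<open>r\<close> of merges that were forced by a level of at least \<open>\<theta>\<close>.\<close>

definition guarded :: "nat list set \<Rightarrow> nat \<Rightarrow> (nat \<times> nat) set \<Rightarrow> (nat \<times> nat) set \<Rightarrow> bool" where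
  "guarded P r M B \<longleftrightarrow> position M B \<and> path_system M P \<and> (\<Union>p\<in>P. set p) = {1..n} \<and>
     box_danger P B \<le> K \<and> \<theta> * r + levels P B \<le> 2 * card B"

definition calm :: "nat list set \<Rightarrow> (nat \<times> nat) set \<Rightarrow> bool" where
  "calm P B \<longleftrightarrow> (\<forall>p\<in>P. out_count B (last p) < \<theta> \<and> in_count B (hd p) < \<theta>)"

definition merge :: "nat list set \<Rightarrow> nat list \<Rightarrow> nat list \<Rightarrow> nat list set" where
  "merge P p q = insert (p @ q) (P - {p, q})"

lemma guarded_facts:
  assumes "guarded P r M B"
  shows "position M B" "path_system M P" "(\<Union>p\<in>P. set p) = {1..n}" "box_danger P B \<le> K"
    "\<theta> * r + levels P B \<le> 2 * card B" "finite P" "finite B"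
proof -
  show pos: "position M B" and sys: "path_system M P" and "(\<Union>p\<in>P. set p) = {1..n}"
    and "box_danger P B \<le> K" and "\<theta> * r + levels P B \<le> 2 * card B"
    using assms unfolding guarded_def by simp_all
  show "finite B" by (rule finite_if_position[OF pos])
  show "finite P" using sys by (simp add: path_system_def)
qed

lemma path_system_facts:
  assumes "path_system M P" "p \<in> P"
  shows "p \<noteq> []" "distinct p" "path_in M p" "last p \<in> set p" "hd p \<in> set p"
  using assms by (simp_all add: path_system_def)

lemma merge_facts:
  assumes sys: "path_system M P" and pq: "p \<in> P" "q \<in> P" "p \<noteq> q"
  shows "path_system (insert (last p, hd q) M) (merge P p q)"
    and "(\<Union>x\<in>merge P p q. set x) = (\<Union>x\<in>P. set x)"
    and "last ` merge P p q = last ` P - {last p}"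
    and "hd ` merge P p q = hd ` P - {hd q}"
    and "card (merge P p q) + 1 = card P"
proof -
  let ?M = "insert (last p, hd q) M"
  note p = path_system_facts[OF sys pq(1)] and q = path_system_facts[OF sys pq(2)]
  have finP: "finite P" using sys by (simp add: path_system_def)
  have disj: "set p \<inter> set q = {}" by (rule path_system_disjoint[OF sys pq])
  have sys': "path_system ?M P" by (rule path_system_mono[OF sys]) auto
  have "path_in ?M (p @ q)"
    using path_system_facts(3)[OF sys' pq(1)] path_system_facts(3)[OF sys' pq(2)]
    by (simp add: successively_append_iff)
  moreover have "distinct (p @ q)" using p q disj by simp
  moreover have new: "set (p @ q) \<inter> set x = {}" if "x \<in> P - {p, q}" for x
  proof -
    have "x \<in> P" "p \<noteq> x" "q \<noteq> x" using that by auto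
    then have "set p \<inter> set x = {}" "set q \<inter> set x = {}"
      using path_system_disjoint[OF sys] pq by simp_all
    then show ?thesis by (simp add: Int_Un_distrib2)
  qed
  moreover have "path_system ?M (P - {p, q})" by (rule path_system_subset[OF sys']) auto
  ultimately show "path_system ?M (merge P p q)"
    unfolding path_system_def merge_def using p(1) by (simp add: Int_commute)
  have "P = insert p (insert q (P - {p, q}))" using pq by blast
  then have "(\<Union>x\<in>P. set x) = set p \<union> (set q \<union> (\<Union>x\<in>P - {p, q}. set x))"
    by (metis UN_insert)
  then show "(\<Union>x\<in>merge P p q. set x) = (\<Union>x\<in>P. set x)"
    by (simp add: merge_def Un_assoc)
  note inj = path_system_inj[OF sys]
  have "last q \<noteq> last p" "hd q \<noteq> hd p" using p(4,5) q(4,5) disj by (metis disjoint_iff)+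
  moreover have "last ` (P - {p, q}) = last ` P - {last p, last q}"
    "hd ` (P - {p, q}) = hd ` P - {hd p, hd q}"
    using inj_on_image_set_diff[OF inj(1), of P "{p, q}"]
      inj_on_image_set_diff[OF inj(2), of P "{p, q}"] pq by simp_all
  moreover have "last q \<in> last ` P" "hd p \<in> hd ` P" using pq by simp_all
  ultimately show "last ` merge P p q = last ` P - {last p}" "hd ` merge P p q = hd ` P - {hd q}"
    unfolding merge_def using p(1) q(1) by auto
  have "p @ q \<notin> P - {p, q}"
  proof
    assume "p @ q \<in> P - {p, q}"
    then have "set (p @ q) \<inter> set (p @ q) = {}" by (rule new)
    then show False using p(1) by simp
  qed
  then have "card (merge P p q) = Suc (card (P - {p, q}))" using finP by (simp add: merge_def)
  also have "card (P - {p, q}) = card P - 2" using finP pq by (simp add: card_Diff_subset)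
  also have "2 \<le> card P" using card_mono[OF finP, of "{p, q}"] pq by simp
  then have "Suc (card P - 2) + 1 = card P" by simp
  finally show "card (merge P p q) + 1 = card P" by simp
qed

lemma merge_keeps_long:
  assumes "g \<in> P" "i \<le> length g"
  shows "\<exists>g'\<in>merge P p q. i \<le> length g'"
  using assms unfolding merge_def by (cases "g = p \<or> g = q") auto

lemma card_path_system_le:
  assumes "path_system M P" "(\<Union>p\<in>P. set p) = {1..n}"
  shows "card P \<le> n"
proof -
  have "hd ` P \<subseteq> (\<Union>p\<in>P. set p)" using path_system_facts(5)[OF assms(1)] by blast
  then have "card (hd ` P) \<le> card {1..n}" unfolding assms(2) by (intro card_mono) auto
  then show ?thesis using card_image[OF path_system_inj(2)[OF assms(1)]] by simp
qed

lemma levels_grow: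
  assumes "finite P" "finite B'" "B \<subseteq> B'"
  shows "levels P B' + 2 * card B \<le> levels P B + 2 * card B'"
proof -
  have fin: "finite (last ` P)" "finite (hd ` P)" "finite (B' - B)" using assms by auto
  have "levels P B' = levels P B + (\<Sum>v\<in>last ` P. out_count (B' - B) v) + (\<Sum>v\<in>hd ` P. in_count (B' - B) v)"
    unfolding levels_def count_split[OF assms(2,3)] by (simp add: sum.distrib)
  then have "levels P B' \<le> levels P B + 2 * card (B' - B)"
    using sum_count_le(1)[OF fin(3,1)] sum_count_le(2)[OF fin(3,2)] by linarith
  moreover have "card B' = card B + card (B' - B)"
    using assms finite_subset[OF assms(3,2)] by (metis card_Diff_subset card_mono le_add_diff_inverse)
  ultimately show ?thesis by linarith
qed

lemma levels_merge:
  assumes "path_system M P" "p \<in> P" "q \<in> P" "p \<noteq> q"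
  shows "levels (merge P p q) B + out_count B (last p) + in_count B (hd q) = levels P B"
proof -
  have fin: "finite (last ` P)" "finite (hd ` P)" using assms(1) by (simp_all add: path_system_def)
  show ?thesis
    unfolding levels_def merge_facts(3,4)[OF assms]
    using sum.remove[OF fin(1), of "last p" "out_count B"] sum.remove[OF fin(2), of "hd q" "in_count B"]
      assms(2,3) by simp
qed

lemma danger_merge:
  assumes "path_system M P" "p \<in> P" "q \<in> P" "p \<noteq> q"
  shows "box_danger (merge P p q) B + weight b (out_count B (last p)) + weight b (in_count B (hd q)) =
    box_danger P B"
proof -
  have fin: "finite (last ` P)" "finite (hd ` P)" using assms(1) by (simp_all add: path_system_def)
  show ?thesis
    unfolding danger_def merge_facts(3,4)[OF assms]
    using sum.remove[OF fin(1), of "last p" "\<lambda>v. weight b (out_count B v)"]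
      sum.remove[OF fin(2), of "hd q" "\<lambda>v. weight b (in_count B v)"] assms(2,3) by simp
qed

lemma K_nonneg: "0 \<le> K"
proof -
  have "0 \<le> 2 * real n * weight b (\<theta> + b)" by simp
  then show ?thesis using theta(2) by linarith
qed

lemma level_bound:
  assumes "guarded P r M B" "p \<in> P"
  shows "100 * out_count B (last p) \<le> n" "100 * in_count B (hd p) \<le> n"
proof -
  note G = guarded_facts[OF assms(1)]
  have fin: "finite (last ` P)" "finite (hd ` P)" using G(6) by simp_all
  have "weight b (out_count B (last p)) \<le> box_danger P B" "weight b (in_count B (hd p)) \<le> box_danger P B"
    using danger_level[OF fin] assms(2) by simp_all
  then have "weight b (out_count B (last p)) \<le> 2 * K" "weight b (in_count B (hd p)) \<le> 2 * K"
    using G(4) K_nonneg by linarith+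
  then show "100 * out_count B (last p) \<le> n" "100 * in_count B (hd p) \<le> n" using level by simp_all
qed

text \<open>Different paths have different starts and ends, so the blocked partners number at most
  the level, hence at most \<open>n / 100\<close>, out of about \<open>n / 2\<close>.\<close>

lemma free_partner:
  assumes G: "guarded P r M B" and p: "p \<in> P" and large: "n \<le> 2 * card P"
  shows "\<exists>q\<in>P. q \<noteq> p \<and> (last p, hd q) \<notin> B" "\<exists>q\<in>P. q \<noteq> p \<and> (last q, hd p) \<notin> B"
proof -
  note F = guarded_facts[OF G]
  note inj = path_system_inj[OF F(2)]
  have card: "card (P - {p}) = card P - 1" using p F(6) by simp
  have *: "\<exists>q\<in>P. q \<noteq> p \<and> q \<notin> D" if "D \<subseteq> P - {p}" "100 * card D \<le> n" for D
  proof -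
    have "card D < card (P - {p})" using that(2) large n_ge unfolding card by linarith
    then have "D \<noteq> P - {p}" by (metis order_less_irrefl)
    then show ?thesis using that(1) by blast
  qed
  let ?D1 = "{q \<in> P - {p}. (last p, hd q) \<in> B}"
  have "card ?D1 = card ((\<lambda>q. (last p, hd q)) ` ?D1)"
    by (rule card_image[symmetric], rule inj_onI) (use inj_onD[OF inj(2)] in auto)
  also have "\<dots> \<le> out_count B (last p)"
    unfolding out_count_def using F(7) by (intro card_mono) auto
  finally have "100 * card ?D1 \<le> n" using level_bound(1)[OF G p] by linarith
  then show "\<exists>q\<in>P. q \<noteq> p \<and> (last p, hd q) \<notin> B" using *[of ?D1] by auto
  let ?D2 = "{q \<in> P - {p}. (last q, hd p) \<in> B}"
  have "card ?D2 = card ((\<lambda>q. (last q, hd p)) ` ?D2)"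
    by (rule card_image[symmetric], rule inj_onI) (use inj_onD[OF inj(1)] in auto)
  also have "\<dots> \<le> in_count B (hd p)"
    unfolding in_count_def using F(7) by (intro card_mono) auto
  finally have "100 * card ?D2 \<le> n" using level_bound(2)[OF G p] by linarith
  then show "\<exists>q\<in>P. q \<noteq> p \<and> (last q, hd p) \<notin> B" using *[of ?D2] by auto
qed

lemma link_in_board:
  assumes "guarded P r M B" "p \<in> P" "q \<in> P" "p \<noteq> q"
  shows "(last p, hd q) \<in> board n"
proof -
  note F = guarded_facts[OF assms(1)]
  have "last p \<in> set p" "hd q \<in> set q" using path_system_facts[OF F(2)] assms(2,3) by simp_all
  moreover from this have "last p \<in> {1..n}" "hd q \<in> {1..n}"
    unfolding F(3)[symmetric] using assms(2,3) by (metis UN_I)+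
  moreover have "set p \<inter> set q = {}" by (rule path_system_disjoint[OF F(2) assms(2-4)])
  ultimately show ?thesis unfolding board_iff by (metis disjoint_iff)
qed

text \<open>\<open>r'\<close> is \<open>Suc r\<close> for a forced merge, paid for by the level that
  disappears, and \<open>r\<close> for a voluntary one. The danger bound is a premise because it has
  a different reason in the two cases.\<close>

lemma guarded_merge_step:
  assumes G: "guarded P r M B" and pq: "p \<in> P" "q \<in> P" "p \<noteq> q"
    and M': "M \<subseteq> M'" "(last p, hd q) \<in> M'" "B \<subseteq> B'" "position M' B'"
    and K: "box_danger (merge P p q) B' \<le> K"
    and r: "\<theta> * r' \<le> \<theta> * r + out_count B (last p) + in_count B (hd q)"
  shows "guarded (merge P p q) r' M' B'"
proof -
  note F = guarded_facts[OF G]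
  have finB': "finite B'" by (rule finite_if_position[OF M'(4)])
  have "path_system M' (merge P p q)"
    by (rule path_system_mono[OF merge_facts(1)[OF F(2) pq]]) (use M' in auto)
  moreover have "(\<Union>x\<in>merge P p q. set x) = {1..n}"
    using merge_facts(2)[OF F(2) pq] F(3) by simp
  moreover have "finite (merge P p q)" using F(6) by (simp add: merge_def)
  from levels_grow[OF this finB' M'(3)]
  have "\<theta> * r' + levels (merge P p q) B' \<le> 2 * card B'"
    using r levels_merge[OF F(2) pq, of B] F(5) by linarith
  ultimately show ?thesis using M'(4) K by (simp add: guarded_def)
qed

text \<open>The reply lifts no level above \<open>\<theta> + b\<close>, and there are at most
  \<open>n\<close> ends and \<open>n\<close> starts. So in a calm position Maker may spend her move
  elsewhere.\<close>

lemma calm_danger: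
  assumes G: "guarded P r M B" and calm: "calm P B"
    and B': "B \<subseteq> B'" "card (B' - B) \<le> b" "position M' B'"
  shows "box_danger P B' \<le> K"
proof -
  note F = guarded_facts[OF G]
  have finB': "finite B'" by (rule finite_if_position[OF B'(3)])
  have "weight b (out_count B' v) \<le> weight b (\<theta> + b)" if "v \<in> last ` P" for v
    using that calm count_grow(1)[OF finB' B'(1,2), of v] unfolding calm_def
    by (intro weight_mono) fastforce
  then have "(\<Sum>v\<in>last ` P. weight b (out_count B' v)) \<le> real (card (last ` P)) * weight b (\<theta> + b)"
    by (rule sum_bounded_above)
  moreover have "weight b (in_count B' v) \<le> weight b (\<theta> + b)" if "v \<in> hd ` P" for v
    using that calm count_grow(2)[OF finB' B'(1,2), of v] unfolding calm_def
    by (intro weight_mono) fastforce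
  then have "(\<Sum>v\<in>hd ` P. weight b (in_count B' v)) \<le> real (card (hd ` P)) * weight b (\<theta> + b)"
    by (rule sum_bounded_above)
  moreover have "real (card (f ` P)) * weight b (\<theta> + b) \<le> real n * weight b (\<theta> + b)"
    for f :: "nat list \<Rightarrow> nat"
    using card_image_le[OF F(6), of f] card_path_system_le[OF F(2,3)]
    by (intro mult_right_mono) auto
  ultimately have "box_danger P B' \<le> real n * weight b (\<theta> + b) + real n * weight b (\<theta> + b)"
    unfolding danger_def by (meson add_mono order_trans)
  also have "\<dots> = 2 * real n * weight b (\<theta> + b)" by simp
  finally show ?thesis using theta(2) by linarith
qed

lemma guarded_calm_step:
  assumes G: "guarded P r M B" and calm: "calm P B"
    and M': "M \<subseteq> M'" and B': "B \<subseteq> B'" "card (B' - B) \<le> b" "position M' B'"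
  shows "guarded P r M' B'"
proof -
  note F = guarded_facts[OF G]
  have finB': "finite B'" by (rule finite_if_position[OF B'(3)])
  have "\<theta> * r + levels P B' \<le> 2 * card B'"
    using levels_grow[OF F(6) finB' B'(1)] F(5) by linarith
  then show ?thesis
    using calm_danger[OF G calm B'] path_system_mono[OF F(2) M'] F(3) B'(3) by (simp add: guarded_def)
qed

text \<open>The merge removes a loose side of highest level. Its weight pays for the growth of the
  others during the reply, and its level, at least \<open>\<theta>\<close>, pays for the increase of
  \<open>r\<close>.\<close>

lemma reset:
  assumes G: "guarded P r M B" and busy: "\<not> calm P B" and large: "n \<le> 2 * card P"
  shows "\<exists>p\<in>P. \<exists>q\<in>P. p \<noteq> q \<and> (last p, hd q) \<notin> B \<and>
    (\<forall>M' B'. M \<subseteq> M' \<longrightarrow> (last p, hd q) \<in> M' \<longrightarrow> B \<subseteq> B' \<longrightarrow> card (B' - B) \<le> b \<longrightarrow> position M' B' \<longrightarrow>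
       guarded (merge P p q) (Suc r) M' B')"
proof -
  note F = guarded_facts[OF G]
  define lev where "lev p = max (out_count B (last p)) (in_count B (hd p))" for p
  have "P \<noteq> {}" using large n_ge by auto
  then have "Max (lev ` P) \<in> lev ` P" using F(6) by (intro Max_in) auto
  then obtain p0 where p0: "p0 \<in> P" "lev p0 = Max (lev ` P)" by auto
  have lev_max: "lev p \<le> lev p0" if "p \<in> P" for p
    using that F(6) unfolding p0(2) by (intro Max_ge) auto
  obtain p1 where "p1 \<in> P" "\<theta> \<le> lev p1"
    using busy unfolding calm_def lev_def by (metis le_max_iff_disj not_le)
  then have high: "\<theta> \<le> lev p0" using lev_max[of p1] by linarith
  have "\<exists>p\<in>P. \<exists>q\<in>P. p \<noteq> q \<and> (last p, hd q) \<notin> B \<and>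
      (lev p0 = out_count B (last p) \<or> lev p0 = in_count B (hd q))"
  proof (cases "lev p0 = out_count B (last p0)")
    case True
    then show ?thesis using free_partner(1)[OF G p0(1) large] p0(1) by metis
  next
    case False
    then have "lev p0 = in_count B (hd p0)" by (auto simp: lev_def max_def split: if_splits)
    then show ?thesis using free_partner(2)[OF G p0(1) large] p0(1) by metis
  qed
  then obtain p q where pq: "p \<in> P" "q \<in> P" "p \<noteq> q" "(last p, hd q) \<notin> B"
    "lev p0 = out_count B (last p) \<or> lev p0 = in_count B (hd q)" by blast
  have "guarded (merge P p q) (Suc r) M' B'"
    if M': "M \<subseteq> M'" "(last p, hd q) \<in> M'" "B \<subseteq> B'" "card (B' - B) \<le> b" "position M' B'" for M' B'
  proof (rule guarded_merge_step[OF G pq(1-3) M'(1-3,5)])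
    have finB': "finite B'" by (rule finite_if_position[OF M'(5)])
    let ?w = "weight b (lev p0)"
    have "last ` merge P p q \<subseteq> last ` P" "hd ` merge P p q \<subseteq> hd ` P"
      using merge_facts(3,4)[OF F(2) pq(1-3)] by auto
    note sub = this
    have "box_danger (merge P p q) B' \<le> box_danger (merge P p q) B + ?w"
    proof (rule danger_grow[OF b(1) _ _ _ finB' M'(3,4)])
      fix v assume "v \<in> last ` merge P p q"
      then obtain x where "x \<in> P" "v = last x" using sub(1) by blast
      then show "weight b (out_count B v) \<le> ?w"
        using lev_max[of x] by (intro weight_mono) (simp add: lev_def[of x])
    next
      fix v assume "v \<in> hd ` merge P p q"
      then obtain x where "x \<in> P" "v = hd x" using sub(2) by blast
      then show "weight b (in_count B v) \<le> ?w"
        using lev_max[of x] by (intro weight_mono) (simp add: lev_def[of x])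
    qed (use F(6) in \<open>simp_all add: merge_def\<close>)
    also have "?w \<le> weight b (out_count B (last p)) + weight b (in_count B (hd q))"
      using pq(5) weight_nonneg[of b "out_count B (last p)"] weight_nonneg[of b "in_count B (hd q)"]
      by (elim disjE) simp_all
    finally show "box_danger (merge P p q) B' \<le> K"
      using danger_merge[OF F(2) pq(1-3), of B] F(4) by linarith
    show "\<theta> * Suc r \<le> \<theta> * r + out_count B (last p) + in_count B (hd q)"
      using high pq(5) by (simp, linarith)
  qed
  then show ?thesis using pq by blast
qed

text \<open>Two levels per arc of Breaker against \<open>\<theta> \<ge> n / 400\<close> per forced
  merge give \<open>n * r \<le> 800 * card B\<close>, and \<open>time\<close> bounds
  \<open>card B\<close>.\<close>

lemma few_resets:
  assumes G: "guarded P r M B" and B: "card B \<le> b * (T + 5 * n)"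
  shows "25 * r \<le> n"
proof -
  have "n * r \<le> 400 * (\<theta> * r)" using mult_le_mono1[OF theta(1), of r] by (simp add: mult.assoc)
  also have "\<dots> \<le> 800 * card B" using guarded_facts(5)[OF G] by linarith
  finally have "25 * (n * r) \<le> 20000 * card B" by linarith
  also have "\<dots> \<le> n * n" using B time by (meson le_trans mult_le_mono2)
  finally have "n * (25 * r) \<le> n * n" by (simp add: mult.left_commute)
  then show ?thesis using n_ge by simp
qed

section \<open>Extending one path and closing it\<close>

lemma card_grow:
  assumes "position M' B'" "B \<subseteq> B'" "card (B' - B) \<le> c"
  shows "card B' \<le> card B + c"
  using finite_if_position[OF assms(1)] assms(2,3)
  by (metis card_Diff_subset card_mono finite_subset le_add_diff_inverse nat_add_left_cancel_le)

text \<open>\<open>i\<close> counts voluntary merges, each adding at least one vertex to the long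
  path. While \<open>4 * length g < n\<close>, both \<open>i < n / 4\<close> and
  \<open>r \<le> n / 25\<close>, so at least \<open>n / 2\<close> paths remain as partners. A forced
  merge may involve \<open>g\<close>, which then survives inside a longer path.\<close>

lemma extend_phase:
  assumes "guarded P r M B" "hits {1..n} s t M" "g \<in> P" "i \<le> length g"
    and "card P + r + i = n" "card B \<le> b * (T + r + i)"
  shows "force M B"
  using assms
proof (induction "card P" arbitrary: P r M B g i rule: less_induct)
  case less
  note G = less.prems(1)
  note F = guarded_facts[OF G]
  have "T + r + i \<le> T + 5 * n" using less.prems(5) by linarith
  then have "card B \<le> b * (T + 5 * n)"
    using less.prems(6) by (meson le_trans mult_le_mono2)
  then have few: "25 * r \<le> n" by (rule few_resets[OF G])
  show ?case
  proof (cases "n \<le> 4 * length g")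
    case True
    note g = path_system_facts[OF F(2) less.prems(3)]
    have "set g \<subseteq> {1..n}" unfolding F(3)[symmetric] using less.prems(3) by (rule UN_upper)
    moreover have "50 * out_count B (last g) \<le> n" "50 * (in_count B (hd g) + b) \<le> n"
      using level_bound[OF G less.prems(3)] b(2) unfolding distrib_left by linarith+
    ultimately show ?thesis
    proof (intro close_path[OF F(1) g(3,2) _ True less.prems(2)])
      fix M' B' R
      assume 1: "M \<subseteq> M'" "B \<subseteq> B'" "card (B' - B) \<le> 2 * b" "position M' B'" "cycle_in M' R" "set R = set g"
      let ?P = "P - {g}"
      have finB': "finite B'" by (rule finite_if_position[OF 1(4)])
      have fin: "finite (last ` P)" "finite (hd ` P)" using F(6) by simp_all
      have "length R = length g"
        using 1(5,6) g(2) distinct_card[of R] distinct_card[of g] by (simp add: cycle_in_def)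
      then have "n \<le> 4 * length R" using True by simp
      moreover have "path_system M' ?P"
        by (rule path_system_subset[OF path_system_mono[OF F(2) 1(1)]]) auto
      moreover have "set R \<union> (\<Union>p\<in>?P. set p) = {1..n}"
        using less.prems(3) unfolding F(3)[symmetric] 1(6) by blast
      moreover have "set R \<inter> set p = {}" if "p \<in> ?P" for p
        using path_system_disjoint[OF F(2) less.prems(3), of p] that 1(6) by auto
      moreover have "hits {1..n} s t M'" by (rule hits_mono[OF less.prems(2) 1(1)])
      \<comment> \<open>All weights are at most \<open>K\<close>, so the two replies during the
        closing add at most \<open>K\<close>; this is why \<open>level\<close> and
        \<open>absorb_paths\<close> work with \<open>2 * K\<close>.\<close>
      moreover have "box_danger ?P B' \<le> 2 * K"
      proof -
        have sub: "last ` ?P \<subseteq> last ` P" "hd ` ?P \<subseteq> hd ` P" by auto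
        have mono: "box_danger ?P B \<le> box_danger P B"
          unfolding danger_def using fin sub by (intro add_mono sum_mono2) auto
        have "box_danger ?P B' \<le> box_danger ?P B + K"
        proof (rule danger_grow[OF b(1) _ _ _ finB' 1(2,3)])
          fix v assume "v \<in> last ` ?P"
          then have "v \<in> last ` P" using sub(1) by blast
          from danger_level(1)[OF fin this, of b B]
          show "weight b (out_count B v) \<le> K" using F(4) by linarith
        next
          fix v assume "v \<in> hd ` ?P"
          then have "v \<in> hd ` P" using sub(2) by blast
          from danger_level(2)[OF fin this, of b B]
          show "weight b (in_count B v) \<le> K" using F(4) by linarith
        qed (use F(6) K_nonneg in simp_all)
        then show ?thesis using mono F(4) by linarith
      qed
      moreover have "20000 * (card B' + 3 * b * card ?P) \<le> n * n"
      proof -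
        have "card B' \<le> b * (T + r + i) + 2 * b" using card_grow[OF 1(4,2,3)] less.prems(6) by linarith
        moreover have "3 * b * card ?P \<le> 3 * b * n"
          using card_path_system_le[OF F(2,3)] F(6) less.prems(3)
          by (intro mult_le_mono2) (simp add: card_Diff_singleton)
        \<comment> \<open>The budget \<open>5 * n\<close> covers at most \<open>n\<close> merges,
          two closing moves and three moves for each absorbed path.\<close>
        moreover have "b * (T + r + i) + 2 * b + 3 * b * n \<le> b * (T + 5 * n)"
        proof -
          have "T + r + i + 2 + 3 * n \<le> T + 5 * n" using less.prems(5) n_ge by linarith
          then have "b * (T + r + i + 2 + 3 * n) \<le> b * (T + 5 * n)" by (rule mult_le_mono2)
          then show ?thesis by (simp add: distrib_left mult.commute)
        qed
        ultimately have "card B' + 3 * b * card ?P \<le> b * (T + 5 * n)" by linarith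
        then show ?thesis using time by (meson le_trans mult_le_mono2)
      qed
      ultimately show "force M' B'" using 1(4,5) by (intro absorb_paths[of M' B' R ?P]) auto
    qed
  next
    case False
    then have large: "n \<le> 2 * card P" using less.prems(4,5) few by linarith
    show ?thesis
    proof (cases "calm P B")
      case True
      obtain q where q: "q \<in> P" "q \<noteq> g" "(last g, hd q) \<notin> B"
        using free_partner(1)[OF G less.prems(3) large] by blast
      have gq: "g \<noteq> q" using q(2) by simp
      show ?thesis
      proof (rule force_claim[OF F(1) link_in_board[OF G less.prems(3) q(1) gq] q(3)])
        fix M' B'
        assume 1: "M \<subseteq> M'" "(last g, hd q) \<in> M'" "B \<subseteq> B'" "card (B' - B) \<le> b" "position M' B'"
        note mf = merge_facts[OF F(2) less.prems(3) q(1) gq]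
        have "box_danger (merge P g q) B' \<le> box_danger P B'"
          using danger_merge[OF F(2) less.prems(3) q(1) gq, of B'] weight_nonneg[of b "out_count B' (last g)"]
            weight_nonneg[of b "in_count B' (hd q)"] by linarith
        also have "\<dots> \<le> K" by (rule calm_danger[OF G True 1(3-5)])
        finally have "guarded (merge P g q) r M' B'"
          by (rule guarded_merge_step[OF G less.prems(3) q(1) gq 1(1,2,3,5)]) simp
        moreover have "q \<noteq> []" by (rule path_system_facts(1)[OF F(2) q(1)])
        then have "Suc i \<le> length (g @ q)" using less.prems(4) by (cases q) auto
        moreover have "card B' \<le> b * (T + r + Suc i)"
          using card_grow[OF 1(5,3,4)] less.prems(6) by simp
        moreover have "g @ q \<in> merge P g q" by (simp add: merge_def)
        ultimately show "force M' B'"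
          using mf(5) less.prems(5) hits_mono[OF less.prems(2) 1(1)]
          by (intro less.hyps[of "merge P g q" r M' B' "g @ q" "Suc i"]) simp_all
      qed
    next
      case False
      obtain p q where pq: "p \<in> P" "q \<in> P" "p \<noteq> q" "(last p, hd q) \<notin> B"
        and step: "\<And>M' B'. M \<subseteq> M' \<Longrightarrow> (last p, hd q) \<in> M' \<Longrightarrow> B \<subseteq> B' \<Longrightarrow> card (B' - B) \<le> b \<Longrightarrow>
          position M' B' \<Longrightarrow> guarded (merge P p q) (Suc r) M' B'"
        using reset[OF G False large] by metis
      show ?thesis
      proof (rule force_claim[OF F(1) link_in_board[OF G pq(1-3)] pq(4)])
        fix M' B'
        assume 1: "M \<subseteq> M'" "(last p, hd q) \<in> M'" "B \<subseteq> B'" "card (B' - B) \<le> b" "position M' B'"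
        obtain g' where g': "g' \<in> merge P p q" "i \<le> length g'"
          using merge_keeps_long[OF less.prems(3,4)] by blast
        have "card B' \<le> b * (T + Suc r + i)"
          using card_grow[OF 1(5,3,4)] less.prems(6) by simp
        then show "force M' B'"
          using step[OF 1] g' merge_facts(5)[OF F(2) pq(1-3)] less.prems(5) hits_mono[OF less.prems(2) 1(1)]
          by (intro less.hyps[of "merge P p q" "Suc r" M' B' g' i]) simp_all
      qed
    qed
  qed
qed

end

section \<open>Rectangles as the sets to be hit\<close>

definition rectangles :: "'a set \<Rightarrow> nat \<Rightarrow> nat \<Rightarrow> ('a \<times> 'a) set set" where
  "rectangles V s t =
     (\<lambda>(A, B). A \<times> B) ` {(A, B). A \<subseteq> V \<and> B \<subseteq> V \<and> A \<inter> B = {} \<and> card A = s \<and> card B = t} \<union>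
     (\<lambda>(A, B). B \<times> A) ` {(A, B). A \<subseteq> V \<and> B \<subseteq> V \<and> A \<inter> B = {} \<and> card A = s \<and> card B = t}"

lemma rectangles_finite_card:
  assumes "finite V"
  shows "finite (rectangles V s t)" "card (rectangles V s t) \<le> 2 * 4 ^ card V"
proof -
  let ?S = "{(A, B). A \<subseteq> V \<and> B \<subseteq> V \<and> A \<inter> B = {} \<and> card A = s \<and> card B = t}"
  have sub: "?S \<subseteq> Pow V \<times> Pow V" by auto
  have fin: "finite (Pow V \<times> Pow V)" using assms by simp
  have finS: "finite ?S" by (rule finite_subset[OF sub fin])
  then show "finite (rectangles V s t)" unfolding rectangles_def by simp
  have "card ?S \<le> card (Pow V \<times> Pow V)" by (rule card_mono[OF fin sub])
  also have "\<dots> = 4 ^ card V"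
    using assms by (simp add: card_cartesian_product card_Pow flip: power_mult_distrib)
  finally have "card ?S \<le> 4 ^ card V" .
  moreover have "card (rectangles V s t) \<le> card ?S + card ?S"
    unfolding rectangles_def
    by (rule order_trans[OF card_Un_le add_mono]) (rule card_image_le[OF finS])+
  ultimately show "card (rectangles V s t) \<le> 2 * 4 ^ card V" by linarith
qed

lemma rectangles_mem:
  assumes "R \<in> rectangles V s t"
  shows "R \<subseteq> V \<times> V" "\<forall>(u, v)\<in>R. u \<noteq> v" "card R = s * t"
proof -
  obtain A B where "A \<subseteq> V" "B \<subseteq> V" "A \<inter> B = {}" "card A = s" "card B = t" "R = A \<times> B \<or> R = B \<times> A"
    using assms unfolding rectangles_def by auto
  then show "R \<subseteq> V \<times> V" "\<forall>(u, v)\<in>R. u \<noteq> v" "card R = s * t"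
    by (auto simp: card_cartesian_product)
qed

lemma hits_if_rectangles:
  assumes "\<And>R. R \<in> rectangles V s t \<Longrightarrow> R \<inter> M \<noteq> {}"
  shows "hits V s t M"
  unfolding hits_def
proof (intro allI impI)
  fix A B :: "'a set"
  assume "A \<subseteq> V" "B \<subseteq> V" "A \<inter> B = {}" "card A = s" "card B = t"
  then have *: "(A, B) \<in> {(A, B). A \<subseteq> V \<and> B \<subseteq> V \<and> A \<inter> B = {} \<and> card A = s \<and> card B = t}" by simp
  have rect: "A \<times> B \<in> rectangles V s t" "B \<times> A \<in> rectangles V s t"
    unfolding rectangles_def using imageI[OF *, of "\<lambda>(A, B). A \<times> B"] imageI[OF *, of "\<lambda>(A, B). B \<times> A"]
    by simp_all
  then show "M \<inter> A \<times> B \<noteq> {} \<and> M \<inter> B \<times> A \<noteq> {}"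
    using assms[OF rect(1)] assms[OF rect(2)] by (simp add: Int_commute)
qed

context maker_parameters
begin

abbreviation unhit :: "(nat \<times> nat) set \<Rightarrow> (nat \<times> nat) set \<Rightarrow> real" where
  "unhit \<equiv> unhit_weight b (rectangles {1..n} s t)"

lemma decay_bounds: "0 \<le> 1 - real l / (2 * real (n * n))" "1 - real l / (2 * real (n * n)) \<le> 1"
proof -
  have "s \<le> n" "t \<le> n" using s t by linarith+
  then have "s * t \<le> n * n" by (rule mult_le_mono)
  then have "l \<le> n * n" using l(1) by linarith
  then have "real l \<le> real (n * n)" by (simp only: of_nat_le_iff)
  moreover have "0 < real (n * n)" using n_ge by simp
  ultimately show "0 \<le> 1 - real l / (2 * real (n * n))" "1 - real l / (2 * real (n * n)) \<le> 1"
    by (simp_all add: divide_simps)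
qed

text \<open>Greedy moves \<open>j\<close> and forced merges \<open>r\<close> are counted separately,
  since the former shrink the potential by a fixed factor and the latter may double it. A greedy
  move lowers \<open>T - j\<close>, a merge lowers \<open>card P\<close>.\<close>

lemma hit_phase:
  assumes "guarded P r M B" "card P + r = n" "j \<le> T" "card B \<le> b * (j + r)"
    and "unhit M B \<le> 2 * 4 ^ n * 2 ^ r * (1 - real l / (2 * real (n * n))) ^ j"
  shows "force M B"
  using assms
proof (induction "T - j + card P" arbitrary: P r M B j rule: less_induct)
  case less
  note G = less.prems(1)
  note F = guarded_facts[OF G]
  let ?d = "1 - real l / (2 * real (n * n))"
  have finR: "finite (rectangles {1..n} s t)" by (rule rectangles_finite_card(1)) simp
  have "r \<le> n" using less.prems(2) by linarith
  then have two: "(2::real) ^ r \<le> 2 ^ n" by (intro power_increasing) auto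
  show ?case
  proof (cases "unhit M B < 1")
    case True
    have "hits {1..n} s t M"
      by (intro hits_if_rectangles unhit_weight_lt_1[OF finR True])
    moreover have "j + r \<le> T + 5 * n" using less.prems(2,3) by linarith
    then have "card B \<le> b * (T + 5 * n)" using less.prems(4) by (meson le_trans mult_le_mono2)
    then have "25 * r \<le> n" by (rule few_resets[OF G])
    then have "P \<noteq> {}" using less.prems(2) n_ge by auto
    then obtain g where "g \<in> P" by blast
    moreover have "b * (j + r) \<le> b * (T + r + 0)" using less.prems(3) by (intro mult_le_mono2) simp
    then have "card B \<le> b * (T + r + 0)" using less.prems(4) by (rule order_trans[rotated])
    ultimately show ?thesis using less.prems(2) by (intro extend_phase[OF G, of g 0]) simp_all
  next
    case False
    have "j \<noteq> T"
    proof
      assume "j = T"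
      then have "unhit M B \<le> 2 * 4 ^ n * 2 ^ r * ?d ^ T" using less.prems(5) by simp
      also have "\<dots> \<le> 2 * 4 ^ n * 2 ^ n * ?d ^ T"
        using two decay_bounds by (intro mult_right_mono mult_left_mono) auto
      finally show False using False l(3) by linarith
    qed
    then have j: "j < T" using less.prems(3) by simp
    have "j + r \<le> T + 5 * n" using less.prems(2,3) by linarith
    then have "card B \<le> b * (T + 5 * n)" using less.prems(4) by (meson le_trans mult_le_mono2)
    then have "25 * r \<le> n" by (rule few_resets[OF G])
    then have large: "n \<le> 2 * card P" using less.prems(2) by linarith
    show ?thesis
    proof (cases "calm P B")
      case True
      have "?d ^ j \<le> 1" using decay_bounds by (intro power_le_one) auto
      then have "2 * 4 ^ n * 2 ^ r * ?d ^ j \<le> 2 * 4 ^ n * 2 ^ n * 1"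
        using two decay_bounds by (intro mult_mono) auto
      \<comment> \<open>Even with all doublings the potential stays below \<open>weight b l\<close>,
        as the greedy argument requires.\<close>
      then have small: "unhit M B < weight b l" using less.prems(5) l(2) by linarith
      have rect: "R \<subseteq> board n \<and> 2 * l \<le> card R" if "R \<in> rectangles {1..n} s t" for R
      proof -
        have "R \<subseteq> board n" using rectangles_mem(1,2)[OF that] by (auto simp: complete_dgraph_def)
        then show ?thesis using rectangles_mem(3)[OF that] l(1) by simp
      qed
      have pos_nn: "0 < n * n" using n_ge by simp
      have disj: "B \<subseteq> board n" "M \<inter> B = {}" using F(1) by simp_all
      have ge1: "1 \<le> unhit M B" using False by simp
      obtain e where e: "e \<in> board n - B" and drop: "\<And>M' B'. insert e M \<subseteq> M' \<Longrightarrow> B \<subseteq> B' \<Longrightarrow>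
          B' \<subseteq> board n \<Longrightarrow> card (B' - B) \<le> b \<Longrightarrow> unhit M' B' \<le> unhit M B * ?d"
        using unhit_weight_greedy[OF b(1) finR finite_board rect card_board_le pos_nn disj small ge1]
        by metis
      obtain u v where uv: "e = (u, v)" by (cases e)
      have uv': "(u, v) \<in> board n" "(u, v) \<notin> B" using e uv by simp_all
      show ?thesis
      proof (rule force_claim[OF F(1) uv'])
        fix M' B'
        assume 1: "M \<subseteq> M'" "(u, v) \<in> M'" "B \<subseteq> B'" "card (B' - B) \<le> b" "position M' B'"
        have "unhit M' B' \<le> unhit M B * ?d" using 1 uv by (intro drop) auto
        also have "\<dots> \<le> 2 * 4 ^ n * 2 ^ r * ?d ^ j * ?d"
          using less.prems(5) decay_bounds by (intro mult_right_mono) auto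
        finally have "unhit M' B' \<le> 2 * 4 ^ n * 2 ^ r * ?d ^ Suc j" by (simp add: mult_ac)
        moreover have "card B' \<le> b * (Suc j + r)"
          using card_grow[OF 1(5,3,4)] less.prems(4) by simp
        ultimately show "force M' B'"
          using guarded_calm_step[OF G True 1(1,3-5)] less.prems(2) j
          by (intro less.hyps[of "Suc j" P r M' B']) simp_all
      qed
    next
      case busy: False
      obtain p q where pq: "p \<in> P" "q \<in> P" "p \<noteq> q" "(last p, hd q) \<notin> B"
        and step: "\<And>M' B'. M \<subseteq> M' \<Longrightarrow> (last p, hd q) \<in> M' \<Longrightarrow> B \<subseteq> B' \<Longrightarrow> card (B' - B) \<le> b \<Longrightarrow>
          position M' B' \<Longrightarrow> guarded (merge P p q) (Suc r) M' B'"
        using reset[OF G busy large] by metis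
      show ?thesis
      proof (rule force_claim[OF F(1) link_in_board[OF G pq(1-3)] pq(4)])
        fix M' B'
        assume 1: "M \<subseteq> M'" "(last p, hd q) \<in> M'" "B \<subseteq> B'" "card (B' - B) \<le> b" "position M' B'"
        have "unhit M' B' \<le> 2 * unhit M B"
          by (rule unhit_weight_double[OF b(1) finR 1(1) finite_if_position[OF 1(5)] 1(3,4)])
        also have "\<dots> \<le> 2 * (2 * 4 ^ n * 2 ^ r * ?d ^ j)"
          using less.prems(5) by (intro mult_left_mono) auto
        finally have "unhit M' B' \<le> 2 * 4 ^ n * 2 ^ Suc r * ?d ^ j" by (simp add: mult_ac)
        moreover have "card B' \<le> b * (j + Suc r)"
          using card_grow[OF 1(5,3,4)] less.prems(4) by simp
        ultimately show "force M' B'"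
          using step[OF 1] merge_facts(5)[OF F(2) pq(1-3)] less.prems(2,3)
          by (intro less.hyps[of j "merge P p q" "Suc r" M' B']) simp_all
      qed
    qed
  qed
qed

lemma maker_wins: "maker_wins_hamiltonian n b"
proof -
  let ?P = "(\<lambda>v. [v]) ` {1..n}"
  have img: "last ` ?P = {1..n}" "hd ` ?P = {1..n}" by (simp_all add: image_image)
  have zero: "out_count {} v = 0" "in_count {} v = 0" for v :: nat
    by (simp_all add: out_count_def in_count_def)
  have "box_danger ?P {} = 2 * real n" unfolding danger_def img by (simp add: zero)
  also have "\<dots> \<le> 2 * real n * weight b (\<theta> + b)"
    using mult_left_mono[OF weight_ge_1[of b "\<theta> + b"], of "2 * real n"] by simp
  also have "\<dots> \<le> K" by (rule theta(2))
  finally have "box_danger ?P {} \<le> K" .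
  moreover have "path_system {} ?P" unfolding path_system_def by auto
  moreover have "levels ?P {} = 0" unfolding levels_def img by (simp add: zero)
  ultimately have "guarded ?P 0 {} {}" unfolding guarded_def by simp
  moreover have "card ?P + 0 = n" by (simp add: card_image inj_on_def)
  moreover have "unhit {} {} \<le> 2 * 4 ^ n * 2 ^ 0 * (1 - real l / (2 * real (n * n))) ^ 0"
  proof -
    have "unhit {} {} = real (card (rectangles {1..n} s t))" by (simp add: unhit_weight_def)
    also have "\<dots> \<le> real (2 * 4 ^ card {1..n})"
      using rectangles_finite_card(2)[of "{1..n}" s t] by (simp only: of_nat_le_iff finite_atLeastAtMost)
    finally show ?thesis by simp
  qed
  ultimately have "force {} {}" by (intro hit_phase[of ?P 0 _ _ 0]) simp_all
  then show ?thesis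
    unfolding maker_wins_hamiltonian_def
    by (intro maker_wins_if_can_force[OF finite_board b(1)]) (rule hamiltonian_mono)
qed

end

section \<open>Choice of the parameters\<close>

lemma power_two_between:
  assumes "1 \<le> s"
  shows "\<exists>m. s \<le> 2 ^ m \<and> (2::nat) ^ m \<le> 2 * s"
proof (cases "s = 1")
  case True
  then show ?thesis by (intro exI[of _ 0]) simp
next
  case False
  then obtain m where "2 ^ m < s" "s \<le> 2 ^ (m + 1)"
    using assms ex_power_ivl2[of 2 s] by auto
  then show ?thesis by (intro exI[of _ "m + 1"]) simp
qed

text \<open>The order \<open>n / ln n\<close> of \<open>s\<close> is forced from both sides:
  \<open>m\<close> windows of size \<open>3 * s\<close>, with \<open>m\<close> of order
  \<open>ln n\<close>, must fit into a quarter of a path, while \<open>s * t\<close> must exceed a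
  multiple of \<open>b * n\<close> for \<open>weight b l\<close> to beat
  \<open>8 ^ n\<close>.\<close>

lemma maker_parameters_exist:
  fixes n b :: nat
  defines "x \<equiv> real n"
  assumes n: "1000 \<le> n" and ln: "1 \<le> ln x"
    and E2: "x / ln x + 200 \<le> x"
    and E3: "96 * (2 * ln x) * (x / (200 * ln x) + 1) \<le> x"
    and E4: "x\<^sup>2 / (20000 * ln x) \<le> x / (200 * ln x) * (x / 24 - 1) / 2 - 1"
    and E5: "160000 * x * ln x + 1 + 5 * x \<le> 200000 * x * ln x"
    and E6: "1 + 12 * ln (4 * x) \<le> 20 * ln x"
    and b: "1 \<le> b" "real b \<le> x / (10 ^ 10 * ln x)"
  shows "\<exists>s t m l \<theta> T K. maker_parameters n b s t m l \<theta> T K"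
proof -
  have x: "1000 \<le> x" using n by (simp add: x_def)
  have bl: "real b * ln x \<le> x / 10 ^ 10" using b(2) ln by (simp add: field_simps)
  have "real b \<le> real b * ln x" using mult_left_mono[OF ln, of "real b"] by simp
  then have b_le: "real b \<le> x / 10 ^ 10" using bl by linarith
  define s where "s = nat \<lceil>x / (200 * ln x)\<rceil>"
  have "0 < x / (200 * ln x)" using x ln by simp
  then have s: "x / (200 * ln x) \<le> real s" "real s \<le> x / (200 * ln x) + 1" "1 \<le> s"
    unfolding s_def by linarith+
  obtain m where m: "s \<le> 2 ^ m" "(2::nat) ^ m \<le> 2 * s" using power_two_between[OF s(3)] by blast
  have m100: "100 * 2 ^ m \<le> n"
  proof -
    have "real (2 ^ m) \<le> real (2 * s)" using m(2) by (simp only: of_nat_le_iff)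
    then have "100 * real (2 ^ m) \<le> 200 * (x / (200 * ln x) + 1)" using s(2) by simp
    also have "\<dots> = x / ln x + 200" by (simp add: field_simps)
    also have "\<dots> \<le> x" by (rule E2)
    finally have "real (100 * 2 ^ m) \<le> real n" by (simp add: x_def)
    then show ?thesis by (simp only: of_nat_le_iff)
  qed
  \<comment> \<open>Read off from \<open>ln (1 / 2) \<le> - 1 / 2\<close>.\<close>
  have ln2: "1 / 2 \<le> ln (2 :: real)" using ln_le_minus_one[of "1 / 2 :: real"] by (simp add: ln_div)
  have "real m * (1 / 2) \<le> real m * ln 2" using ln2 by (intro mult_left_mono) auto
  also have "\<dots> = ln (2 ^ m)" by (simp add: ln_realpow)
  also have "\<dots> \<le> ln x"
  proof -
    have "real (100 * 2 ^ m) \<le> x" using m100 unfolding x_def by (simp only: of_nat_le_iff)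
    then have "100 * (2::real) ^ m \<le> x" by simp
    moreover have "(0::real) \<le> 2 ^ m" by simp
    ultimately have "2 ^ m \<le> x" by linarith
    then show ?thesis using x by (subst ln_le_cancel_iff) auto
  qed
  finally have m_le: "real m \<le> 2 * ln x" by simp
  have ms: "96 * (m * s) \<le> n"
  proof -
    have "96 * (real m * real s) \<le> 96 * ((2 * ln x) * (x / (200 * ln x) + 1))"
      using m_le s(2) ln by (intro mult_left_mono mult_mono) auto
    also have "\<dots> \<le> x" using E3 by (simp add: mult.assoc)
    finally have "real (96 * (m * s)) \<le> real n" by (simp add: x_def)
    then show ?thesis by (simp only: of_nat_le_iff)
  qed
  define t l where "t = n div 24" and "l = (s * t) div 2"
  have "x / 24 - 1 \<le> real t" unfolding t_def x_def by linarith
  then have "x / (200 * ln x) * (x / 24 - 1) \<le> real s * real t"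
    using s(1) x ln by (intro mult_mono) auto
  then have "x / (200 * ln x) * (x / 24 - 1) / 2 - 1 \<le> real (s * t) / 2 - 1"
    unfolding of_nat_mult by (intro diff_right_mono divide_right_mono) auto
  moreover have "real (s * t) / 2 - 1 \<le> real l" unfolding l_def by linarith
  ultimately have l_ge: "x\<^sup>2 / (20000 * ln x) \<le> real l"
    using E4 by (meson order_trans)
  \<comment> \<open>A greedy move multiplies the potential by at most
    \<open>1 - 1 / (40000 * ln x)\<close>, so this many of them give the factor
    \<open>exp (- (4 * x))\<close>.\<close>
  define T where "T = nat \<lceil>160000 * x * ln x\<rceil>"
  have "0 \<le> 160000 * x * ln x" using x ln by simp
  then have T: "160000 * x * ln x \<le> real T" "real T \<le> 160000 * x * ln x + 1"
    unfolding T_def by linarith+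
  \<comment> \<open>Half of the bound \<open>n / 100\<close> in \<open>level\<close>; the other half
    absorbs \<open>b\<close> and the term \<open>6 * b * log 2 (4 * x)\<close> that stems from the
    factor \<open>2 * n\<close> in \<open>K\<close>.\<close>
  define \<theta> where "\<theta> = n div 200"
  have \<theta>: "n \<le> 400 * \<theta>" "200 * \<theta> \<le> n" using n unfolding \<theta>_def by linarith+
  define K where "K = 2 * real n * weight b (\<theta> + b)"
  have "maker_parameters n b s t m l \<theta> T K"
  proof
    have "400 * real b \<le> real n" using b_le x unfolding x_def by simp
    then show "400 * b \<le> n" by linarith
    show "24 * t \<le> n" by (simp add: t_def)
    show "2 * l \<le> s * t" by (simp add: l_def)
    show "2 * real n * weight b (\<theta> + b) \<le> K" by (simp add: K_def)
  next
    fix k assume "weight b k \<le> 2 * K"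
    also have "2 * K = 2 powr (log 2 (4 * x)) * 2 powr (real (\<theta> + b) / (6 * real b))"
      using x unfolding K_def weight_def by (simp add: x_def)
    also have "\<dots> = 2 powr (log 2 (4 * x) + real (\<theta> + b) / (6 * real b))"
      by (simp add: powr_add)
    finally have "real k / (6 * real b) \<le> log 2 (4 * x) + real (\<theta> + b) / (6 * real b)"
      unfolding weight_def by simp
    then have "real k \<le> (log 2 (4 * x) + real (\<theta> + b) / (6 * real b)) * (6 * real b)"
      using b(1) by (simp add: pos_divide_le_eq)
    also have "\<dots> = 6 * real b * log 2 (4 * x) + real \<theta> + real b"
      using b(1) by (simp add: field_simps)
    also have "log 2 (4 * x) \<le> 2 * ln (4 * x)"
    proof -
      have "1 / 2 * ln (4 * x) \<le> ln 2 * ln (4 * x)"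
        using ln2 x by (intro mult_right_mono) auto
      moreover have "ln 2 * log 2 (4 * x) = ln (4 * x)" by (simp add: log_def)
      ultimately have "ln 2 * log 2 (4 * x) \<le> ln 2 * (2 * ln (4 * x))" by simp
      then show ?thesis by simp
    qed
    finally have "real k \<le> real b * (1 + 12 * ln (4 * x)) + real \<theta>"
      using b(1) by (simp add: algebra_simps mult_left_mono)
    also have "real b * (1 + 12 * ln (4 * x)) \<le> real b * (20 * ln x)"
      using E6 by (intro mult_left_mono) auto
    also have "\<dots> \<le> x / 1000" using bl x by simp
    finally have "100 * real k \<le> x" using \<theta>(2) unfolding x_def by linarith
    then show "100 * k \<le> n" unfolding x_def by linarith
  next
    have "real b * (real T + 5 * x) \<le> real b * (200000 * x * ln x)"
      using T(2) E5 by (intro mult_left_mono) auto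
    also have "\<dots> = 200000 * x * (real b * ln x)" by simp
    also have "\<dots> \<le> 200000 * x * (x / 10 ^ 10)" using bl x by (intro mult_left_mono) auto
    finally have "20000 * (real b * (real T + 5 * x)) \<le> 2 / 5 * (x * x)" by simp
    also have "\<dots> \<le> x * x" by simp
    finally have "20000 * (real b * (real T + 5 * x)) \<le> x * x" .
    then have "real (20000 * (b * (T + 5 * n))) \<le> real (n * n)" by (simp add: x_def)
    then show "20000 * (b * (T + 5 * n)) \<le> n * n" by (simp only: of_nat_le_iff)
  next
    \<comment> \<open>The exponent of \<open>weight b l\<close> is at least \<open>4 * x\<close>,
      against \<open>1 + 3 * x\<close> for \<open>2 * 4 ^ n * 2 ^ n\<close>.\<close>
    have "4 * x * (6 * real b) * (20000 * ln x) = 480000 * x * (real b * ln x)" by simp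
    also have "\<dots> \<le> 480000 * x * (x / 10 ^ 10)" using bl x by (intro mult_left_mono) auto
    also have "\<dots> \<le> x\<^sup>2" by (simp add: power2_eq_square)
    finally have "4 * x * (6 * real b) \<le> x\<^sup>2 / (20000 * ln x)"
      using ln by (simp add: pos_le_divide_eq)
    then have "4 * x \<le> real l / (6 * real b)"
      using l_ge b(1) by (simp add: pos_le_divide_eq)
    moreover have "1 + 3 * x < 4 * x" using x by simp
    ultimately have "2 powr (1 + 3 * x) < weight b l" unfolding weight_def by simp
    moreover have "2 powr (1 + 3 * x) = 2 * 4 ^ n * (2::real) ^ n"
    proof -
      have "2 powr (1 + 3 * x) = 2 powr real (1 + 3 * n)" by (simp add: x_def)
      also have "\<dots> = 2 * (2 ^ 3) ^ n" by (simp only: powr_realpow power_add power_mult) simp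
      also have "\<dots> = 2 * 4 ^ n * (2::real) ^ n" by (simp flip: power_mult_distrib)
      finally show ?thesis .
    qed
    ultimately show "2 * 4 ^ n * 2 ^ n < weight b l" by simp
  next
    define d where "d = real l / (2 * real (n * n))"
    have "s \<le> n" "t \<le> n" using m(1) m100 by (linarith, simp add: t_def)
    then have "s * t \<le> n * n" by (rule mult_le_mono)
    then have "l \<le> n * n" by (simp add: l_def)
    then have "real l \<le> real (n * n)" by (simp only: of_nat_le_iff)
    then have d: "d \<le> 1" unfolding d_def using n by (simp add: divide_simps)
    have "1 / (40000 * ln x) = x\<^sup>2 / (20000 * ln x) / (2 * x\<^sup>2)" using x ln by (simp add: field_simps)
    also have "\<dots> \<le> real l / (2 * x\<^sup>2)" by (rule divide_right_mono[OF l_ge]) simp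
    also have "\<dots> = d" by (simp add: d_def x_def power2_eq_square)
    finally have "1 / (40000 * ln x) * (160000 * x * ln x) \<le> d * real T"
      using T(1) x ln by (intro mult_mono) (auto simp: d_def)
    then have "4 * x \<le> d * real T" using ln by simp
    have "(1 - d) ^ T \<le> exp (- d) ^ T"
      using d exp_ge_add_one_self[of "- d"] by (intro power_mono) auto
    also have "\<dots> = exp (- (d * real T))" by (simp add: exp_of_nat_mult[symmetric] mult.commute)
    also have "\<dots> \<le> exp (- (4 * x))" using \<open>4 * x \<le> d * real T\<close> by simp
    also have "\<dots> = inverse (exp 4 ^ n)"
      by (simp add: x_def exp_minus exp_of_nat_mult[symmetric] mult.commute)
    \<comment> \<open>A decay of \<open>16\<close> per vertex outweighs the \<open>8 ^ n\<close>
      from rectangles and doublings.\<close>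
    also have "\<dots> \<le> inverse (16 ^ n)"
    proof -
      have "(16::real) = 2 ^ 4" by simp
      also have "\<dots> \<le> exp 1 ^ 4" using exp_ge_add_one_self[of 1] by (intro power_mono) auto
      also have "\<dots> = exp 4" by (simp flip: exp_of_nat_mult)
      finally show ?thesis by (intro le_imp_inverse_le power_mono) auto
    qed
    finally have "2 * 4 ^ n * 2 ^ n * (1 - d) ^ T \<le> 2 * 4 ^ n * 2 ^ n * inverse (16 ^ n)"
      by (intro mult_left_mono) auto
    also have "\<dots> = 2 * (4 * 2 / 16) ^ n" by (simp only: power_divide power_mult_distrib) (simp add: field_simps)
    also have "\<dots> = 2 * (1 / 2) ^ n" by simp
    also have "\<dots> \<le> 2 * (1 / 2) ^ 2" using n by (intro mult_left_mono power_decreasing) auto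
    also have "\<dots> < 1" by (simp add: power2_eq_square)
    finally show "2 * 4 ^ n * 2 ^ n * (1 - real l / (2 * real (n * n))) ^ T < 1" by (simp add: d_def)
  qed (use b s(3) m(1) m100 ms \<theta>(1) in auto)
  then show ?thesis by blast
qed

lemma maker_side:
  "\<exists>N::nat. \<forall>n\<ge>N. \<forall>b::nat. b \<ge> 1 \<longrightarrow>
     real b \<le> 1 / 10 ^ 10 * real n / ln (real n) \<longrightarrow> maker_wins_hamiltonian n b"
proof -
  have "\<forall>\<^sub>F n::nat in sequentially. 1000 \<le> n" by (rule eventually_ge_at_top)
  moreover have "\<forall>\<^sub>F n::nat in sequentially. 1 \<le> ln (real n)" by real_asymp
  moreover have "\<forall>\<^sub>F n::nat in sequentially. real n / ln (real n) + 200 \<le> real n" by real_asymp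
  moreover have "\<forall>\<^sub>F n::nat in sequentially.
      96 * (2 * ln (real n)) * (real n / (200 * ln (real n)) + 1) \<le> real n" by real_asymp
  moreover have "\<forall>\<^sub>F n::nat in sequentially. (real n)\<^sup>2 / (20000 * ln (real n)) \<le>
      real n / (200 * ln (real n)) * (real n / 24 - 1) / 2 - 1" by real_asymp
  moreover have "\<forall>\<^sub>F n::nat in sequentially.
      160000 * real n * ln (real n) + 1 + 5 * real n \<le> 200000 * real n * ln (real n)" by real_asymp
  moreover have "\<forall>\<^sub>F n::nat in sequentially. 1 + 12 * ln (4 * real n) \<le> 20 * ln (real n)" by real_asymp
  ultimately have "\<forall>\<^sub>F n::nat in sequentially. \<forall>b::nat. b \<ge> 1 \<longrightarrow>
     real b \<le> 1 / 10 ^ 10 * real n / ln (real n) \<longrightarrow> maker_wins_hamiltonian n b"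
  proof eventually_elim
    case (elim n)
    show ?case
    proof (intro allI impI)
      fix b :: nat assume "1 \<le> b" "real b \<le> 1 / 10 ^ 10 * real n / ln (real n)"
      then have "\<exists>s t m l \<theta> T K. maker_parameters n b s t m l \<theta> T K"
        using elim by (intro maker_parameters_exist) (simp_all add: divide_simps)
      then show "maker_wins_hamiltonian n b" using maker_parameters.maker_wins by blast
    qed
  qed
  then show ?thesis by (simp add: eventually_sequentially)
qed

theorem theorem2:
  shows "(\<forall>\<epsilon>::real. \<epsilon> > 0 \<longrightarrow>
            (\<exists>N::nat. \<forall>n\<ge>N. \<forall>b::nat. b \<ge> 1 \<longrightarrow>
               real b \<ge> (1 + \<epsilon>) * real n / ln (real n) \<longrightarrow> breaker_wins_hamiltonian n b))
       \<and> (\<exists>\<beta>::real. \<beta> > 0 \<and>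
            (\<exists>N::nat. \<forall>n\<ge>N. \<forall>b::nat. b \<ge> 1 \<longrightarrow>
               real b \<le> \<beta> * real n / ln (real n) \<longrightarrow> maker_wins_hamiltonian n b))"
proof (intro conjI allI impI)
  show "\<exists>N::nat. \<forall>n\<ge>N. \<forall>b::nat. b \<ge> 1 \<longrightarrow>
      real b \<ge> (1 + \<epsilon>) * real n / ln (real n) \<longrightarrow> breaker_wins_hamiltonian n b"
    if "\<epsilon> > 0" for \<epsilon> :: real
    by (rule breaker_side[OF that])
  show "\<exists>\<beta>::real. \<beta> > 0 \<and> (\<exists>N::nat. \<forall>n\<ge>N. \<forall>b::nat. b \<ge> 1 \<longrightarrow>
      real b \<le> \<beta> * real n / ln (real n) \<longrightarrow> maker_wins_hamiltonian n b)"
    using maker_side by (intro exI[of _ "1 / 10 ^ 10"]) simp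
qed

end
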